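(* Let $n\ge1$ and let $\mathbf M,\mathbf N$ be pointwise finite dimensional $n$-dimensional persistence vector spaces over a field $\mathbb F$. Then $$d_{match}(\rho_{\mathbf M},\rho_{\mathbf N})\le d_I(\mathbf M,\mathbf N),$$ where $$d_{match}(\rho_{\mathbf M},\rho_{\mathbf N})=\sup_{L}\; m^*\cdot d_B\big(B(\mathbf M_L),B(\mathbf N_L)\big),$$ the supremum being over all lines $L$ parameterized by $u=s\vec m+b$ with $m^*=\min_i m_i>0$, $\max_i m_i=1$ and $\sum_{i=1}^n b_i=0$.
   Context: For $u,v\in\mathbb R^n$ write $u\preceq v$ iff $u_i\le v_i$ for all $i$. An $n$-dimensional persistence vector space $\mathbf M$ is a family of $\mathbb F$-vector spaces $\{\mathbf M_u\}_{u\in\mathbb R^n}$ with linear transition maps $\varphi_{\mathbf M}(u,v):\mathbf M_u\to\mathbf M_v$ for $u\preceq v$, satisfying $\varphi_{\mathbf M}(u,u)=\mathrm{Id}$ and $\varphi_{\mathbf M}(v,w)\circ\varphi_{\mathbf M}(u,v)=\varphi_{\mathbf M}(u,w)$; it is pointwise finite dimensional if every $\mathbf M_u$ is finite dimensional. Morphisms are families of linear maps commuting with transition maps. With $\vec\varepsilon=(\varepsilon,\dots,\varepsilon)$, $\mathbf M$ and $\mathbf N$ are $\varepsilon$-interleaved if there are morphisms $\alpha:\mathbf M\to\mathbf N(\vec\varepsilon)$, $\beta:\mathbf N\to\mathbf M(\vec\varepsilon)$ (where $\mathbf M(\vec\varepsilon)_u=\mathbf M_{u+\vec\varepsilon}$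 with shifted transition maps) such that $\beta(u+\vec\varepsilon)\circ\alpha(u)=\varphi_{\mathbf M}(u,u+2\vec\varepsilon)$ and $\alpha(u+\vec\varepsilon)\circ\beta(u)=\varphi_{\mathbf N}(u,u+2\vec\varepsilon)$ for all $u$. The interleaving distance is $d_I(\mathbf M,\mathbf N)=\inf\{\varepsilon\ge0:\mathbf M,\mathbf N\ \varepsilon\text{-interleaved}\}$ (infimum of the empty set is $+\infty$). The rank invariant is $\rho_{\mathbf M}(u,v)=\operatorname{rank}\varphi_{\mathbf M}(u,v)$ for $u\preceq v$. For a line $L$ parameterized by $u=s\vec m+b$ with $\min_i m_i>0$, $\mathbf M_L$ is the 1-dimensional persistence vector space with $(\mathbf M_L)_s=\mathbf M_{s\vec m+b}$ and $\varphi_{\mathbf M_L}(s,s')=\varphi_{\mathbf M}(s\vec m+b,s'\vec m+b)$. A pointwise finite dimensional 1-dimensional persistence vector space $\mathbf P$ decomposes as a direct sum of interval modules, and the multiset of these intervals is its barcode $B(\mathbf P)$ (it depends only on the rank invariant). $d_B$ denotes the bottleneck distance between barcodes: the infimum over partial matchings between the two multisets of intervals of the maximum of (i) the $\ell^\infty$-distance between endpoints of matched intervals and (ii) half the length of each unmatched interval. *)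

theory Defs
  imports Complex_Main "HOL-Library.Extended_Real"
begin

text \<open>Vector spaces over a field 'f are modelled as subspaces of an ambient
  vector space (carrier type 'v with scalar multiplication s).  Points of
  R^n are functions 'n \<Rightarrow> real for a finite index type 'n; the order
  u \<le> v on functions is the pointwise (product) order.\<close>

definition lin_on :: "('f::field \<Rightarrow> 'v::ab_group_add \<Rightarrow> 'v) \<Rightarrow> ('f \<Rightarrow> 'w::ab_group_add \<Rightarrow> 'w)
    \<Rightarrow> 'v set \<Rightarrow> ('v \<Rightarrow> 'w) \<Rightarrow> bool" where
  "lin_on s1 s2 A f \<longleftrightarrow>
     (\<forall>x\<in>A. \<forall>y\<in>A. f (x + y) = f x + f y) \<and> (\<forall>c. \<forall>x\<in>A. f (s1 c x) = s2 c (f x))"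

definition pers_space :: "('f::field \<Rightarrow> 'v::ab_group_add \<Rightarrow> 'v) \<Rightarrow> ('u::order \<Rightarrow> 'v set)
    \<Rightarrow> ('u \<Rightarrow> 'u \<Rightarrow> 'v \<Rightarrow> 'v) \<Rightarrow> bool" where
  "pers_space s M phi \<longleftrightarrow>
     (\<forall>u. module.subspace s (M u)) \<and>
     (\<forall>u v. u \<le> v \<longrightarrow> lin_on s s (M u) (phi u v) \<and> phi u v ` M u \<subseteq> M v) \<and>
     (\<forall>u. \<forall>x\<in>M u. phi u u x = x) \<and>
     (\<forall>u v w. u \<le> v \<longrightarrow> v \<le> w \<longrightarrow> (\<forall>x\<in>M u. phi v w (phi u v x) = phi u w x))"

definition pfd :: "('f::field \<Rightarrow> 'v::ab_group_add \<Rightarrow> 'v) \<Rightarrow> ('u \<Rightarrow> 'v set) \<Rightarrow> bool" where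
  "pfd s M \<longleftrightarrow> (\<forall>u. \<exists>B. finite B \<and> B \<subseteq> M u \<and> M u \<subseteq> module.span s B)"

definition rank_inv :: "('f::field \<Rightarrow> 'v::ab_group_add \<Rightarrow> 'v) \<Rightarrow> ('u \<Rightarrow> 'v set)
    \<Rightarrow> ('u \<Rightarrow> 'u \<Rightarrow> 'v \<Rightarrow> 'v) \<Rightarrow> 'u \<Rightarrow> 'u \<Rightarrow> nat" where
  "rank_inv s M phi u v = vector_space.dim s (phi u v ` M u)"

definition shift :: "('n \<Rightarrow> real) \<Rightarrow> real \<Rightarrow> ('n \<Rightarrow> real)" where
  "shift u e = (\<lambda>i. u i + e)"

definition shifted_morphism :: "('f::field \<Rightarrow> 'v::ab_group_add \<Rightarrow> 'v) \<Rightarrow> (('n \<Rightarrow> real) \<Rightarrow> 'v set)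
    \<Rightarrow> (('n \<Rightarrow> real) \<Rightarrow> ('n \<Rightarrow> real) \<Rightarrow> 'v \<Rightarrow> 'v)
    \<Rightarrow> ('f \<Rightarrow> 'w::ab_group_add \<Rightarrow> 'w) \<Rightarrow> (('n \<Rightarrow> real) \<Rightarrow> 'w set)
    \<Rightarrow> (('n \<Rightarrow> real) \<Rightarrow> ('n \<Rightarrow> real) \<Rightarrow> 'w \<Rightarrow> 'w)
    \<Rightarrow> real \<Rightarrow> (('n \<Rightarrow> real) \<Rightarrow> 'v \<Rightarrow> 'w) \<Rightarrow> bool" where
  "shifted_morphism sM M phiM sN N phiN e alpha \<longleftrightarrow>
     (\<forall>u. lin_on sM sN (M u) (alpha u) \<and> alpha u ` M u \<subseteq> N (shift u e)) \<and>
     (\<forall>u v. u \<le> v \<longrightarrow> (\<forall>x\<in>M u. alpha v (phiM u v x) = phiN (shift u e) (shift v e) (alpha u x)))"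

definition interleaved :: "('f::field \<Rightarrow> 'v::ab_group_add \<Rightarrow> 'v) \<Rightarrow> (('n \<Rightarrow> real) \<Rightarrow> 'v set)
    \<Rightarrow> (('n \<Rightarrow> real) \<Rightarrow> ('n \<Rightarrow> real) \<Rightarrow> 'v \<Rightarrow> 'v)
    \<Rightarrow> ('f \<Rightarrow> 'w::ab_group_add \<Rightarrow> 'w) \<Rightarrow> (('n \<Rightarrow> real) \<Rightarrow> 'w set)
    \<Rightarrow> (('n \<Rightarrow> real) \<Rightarrow> ('n \<Rightarrow> real) \<Rightarrow> 'w \<Rightarrow> 'w) \<Rightarrow> real \<Rightarrow> bool" where
  "interleaved sM M phiM sN N phiN e \<longleftrightarrow>
     (\<exists>alpha beta. shifted_morphism sM M phiM sN N phiN e alpha \<and>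
        shifted_morphism sN N phiN sM M phiM e beta \<and>
        (\<forall>u. \<forall>x\<in>M u. beta (shift u e) (alpha u x) = phiM u (shift u (2*e)) x) \<and>
        (\<forall>u. \<forall>y\<in>N u. alpha (shift u e) (beta u y) = phiN u (shift u (2*e)) y))"

definition interleaving_dist :: "('f::field \<Rightarrow> 'v::ab_group_add \<Rightarrow> 'v) \<Rightarrow> (('n \<Rightarrow> real) \<Rightarrow> 'v set)
    \<Rightarrow> (('n \<Rightarrow> real) \<Rightarrow> ('n \<Rightarrow> real) \<Rightarrow> 'v \<Rightarrow> 'v)
    \<Rightarrow> ('f \<Rightarrow> 'w::ab_group_add \<Rightarrow> 'w) \<Rightarrow> (('n \<Rightarrow> real) \<Rightarrow> 'w set)
    \<Rightarrow> (('n \<Rightarrow> real) \<Rightarrow> ('n \<Rightarrow> real) \<Rightarrow> 'w \<Rightarrow> 'w) \<Rightarrow> ereal" where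
  "interleaving_dist sM M phiM sN N phiN =
     Inf (ereal ` {e. e \<ge> 0 \<and> interleaved sM M phiM sN N phiN e})"

definition real_interval :: "real set \<Rightarrow> bool" where
  "real_interval I \<longleftrightarrow> I \<noteq> {} \<and> (\<forall>x\<in>I. \<forall>z\<in>I. \<forall>y. x \<le> y \<and> y \<le> z \<longrightarrow> y \<in> I)"

text \<open>A barcode is a multiset of intervals, given by a multiplicity function.
  beta is the barcode of a pfd 1-parameter persistence space with rank invariant r iff
  the direct sum of interval modules with these multiplicities has rank invariant r
  (the barcode depends only on the rank invariant).\<close>
definition is_barcode_of_rank :: "(real \<Rightarrow> real \<Rightarrow> nat) \<Rightarrow> (real set \<Rightarrow> nat) \<Rightarrow> bool" where
  "is_barcode_of_rank r beta \<longleftrightarrow>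
     (\<forall>I. beta I > 0 \<longrightarrow> real_interval I) \<and>
     (\<forall>s t. s \<le> t \<longrightarrow> finite {I. beta I > 0 \<and> s \<in> I \<and> t \<in> I} \<and>
        r s t = (\<Sum>I\<in>{I. beta I > 0 \<and> s \<in> I \<and> t \<in> I}. beta I))"

definition barcode :: "('f::field \<Rightarrow> 'v::ab_group_add \<Rightarrow> 'v) \<Rightarrow> (real \<Rightarrow> 'v set)
    \<Rightarrow> (real \<Rightarrow> real \<Rightarrow> 'v \<Rightarrow> 'v) \<Rightarrow> (real set \<Rightarrow> nat)" where
  "barcode s P phi = (THE beta. is_barcode_of_rank (rank_inv s P phi) beta)"

definition lend :: "real set \<Rightarrow> ereal" where "lend I = Inf (ereal ` I)"
definition rend :: "real set \<Rightarrow> ereal" where "rend I = Sup (ereal ` I)"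

definition edist :: "ereal \<Rightarrow> ereal \<Rightarrow> ereal" where
  "edist a b = (if a = b then 0 else \<bar>a - b\<bar>)"

definition mset_elems :: "(real set \<Rightarrow> nat) \<Rightarrow> (real set \<times> nat) set" where
  "mset_elems beta = {(I, k). k < beta I}"

definition partial_matching :: "(real set \<Rightarrow> nat) \<Rightarrow> (real set \<Rightarrow> nat)
    \<Rightarrow> ((real set \<times> nat) \<times> (real set \<times> nat)) set \<Rightarrow> bool" where
  "partial_matching b1 b2 R \<longleftrightarrow> R \<subseteq> mset_elems b1 \<times> mset_elems b2 \<and>
     (\<forall>x y y'. (x, y) \<in> R \<longrightarrow> (x, y') \<in> R \<longrightarrow> y = y') \<and>
     (\<forall>x x' y. (x, y) \<in> R \<longrightarrow> (x', y) \<in> R \<longrightarrow> x = x')"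

definition matching_cost :: "(real set \<Rightarrow> nat) \<Rightarrow> (real set \<Rightarrow> nat)
    \<Rightarrow> ((real set \<times> nat) \<times> (real set \<times> nat)) set \<Rightarrow> ereal" where
  "matching_cost b1 b2 R = Sup ({0} \<union>
     {max (edist (lend (fst x)) (lend (fst y))) (edist (rend (fst x)) (rend (fst y))) | x y. (x, y) \<in> R} \<union>
     {(rend (fst x) - lend (fst x)) / 2 | x. x \<in> mset_elems b1 \<and> x \<notin> Domain R} \<union>
     {(rend (fst y) - lend (fst y)) / 2 | y. y \<in> mset_elems b2 \<and> y \<notin> Range R})"

definition bottleneck_dist :: "(real set \<Rightarrow> nat) \<Rightarrow> (real set \<Rightarrow> nat) \<Rightarrow> ereal" where
  "bottleneck_dist b1 b2 = Inf {matching_cost b1 b2 R | R. partial_matching b1 b2 R}"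

definition line_pt :: "('n \<Rightarrow> real) \<Rightarrow> ('n \<Rightarrow> real) \<Rightarrow> real \<Rightarrow> ('n \<Rightarrow> real)" where
  "line_pt m b s = (\<lambda>i. s * m i + b i)"

definition restrict_line_sp :: "(('n \<Rightarrow> real) \<Rightarrow> 'v set) \<Rightarrow> ('n \<Rightarrow> real) \<Rightarrow> ('n \<Rightarrow> real) \<Rightarrow> real \<Rightarrow> 'v set" where
  "restrict_line_sp M m b s = M (line_pt m b s)"

definition restrict_line_map :: "(('n \<Rightarrow> real) \<Rightarrow> ('n \<Rightarrow> real) \<Rightarrow> 'v \<Rightarrow> 'v)
    \<Rightarrow> ('n \<Rightarrow> real) \<Rightarrow> ('n \<Rightarrow> real) \<Rightarrow> real \<Rightarrow> real \<Rightarrow> 'v \<Rightarrow> 'v" where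
  "restrict_line_map phi m b s t = phi (line_pt m b s) (line_pt m b t)"

definition admissible_line :: "('n::finite \<Rightarrow> real) \<Rightarrow> ('n \<Rightarrow> real) \<Rightarrow> bool" where
  "admissible_line m b \<longleftrightarrow> Min (range m) > 0 \<and> Max (range m) = 1 \<and> (\<Sum>i\<in>UNIV. b i) = 0"

definition matching_dist :: "('f::field \<Rightarrow> 'v::ab_group_add \<Rightarrow> 'v) \<Rightarrow> (('n::finite \<Rightarrow> real) \<Rightarrow> 'v set)
    \<Rightarrow> (('n \<Rightarrow> real) \<Rightarrow> ('n \<Rightarrow> real) \<Rightarrow> 'v \<Rightarrow> 'v)
    \<Rightarrow> ('f \<Rightarrow> 'w::ab_group_add \<Rightarrow> 'w) \<Rightarrow> (('n \<Rightarrow> real) \<Rightarrow> 'w set)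
    \<Rightarrow> (('n \<Rightarrow> real) \<Rightarrow> ('n \<Rightarrow> real) \<Rightarrow> 'w \<Rightarrow> 'w) \<Rightarrow> ereal" where
  "matching_dist sM M phiM sN N phiN =
     (SUP mb \<in> {(m, b). admissible_line m b}.
        ereal (Min (range (fst mb))) *
        bottleneck_dist
          (barcode sM (restrict_line_sp M (fst mb) (snd mb)) (restrict_line_map phiM (fst mb) (snd mb)))
          (barcode sN (restrict_line_sp N (fst mb) (snd mb)) (restrict_line_map phiN (fst mb) (snd mb))))"

end

(* On a line with direction m, an e-interleaving restricts to an interleaving with parameter
   d = e / min m, because the point with parameter s + d dominates the e-shift of the point with
   parameter s.  It remains to show that d-interleaved one-parameter spaces have barcodes at
   bottleneck distance at most d.  As for the induced matchings of Bauer and Lesnick, factor the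
   morphism f : M -> N(d) through its image Q.  The bars of M and Q with a common left end are
   matched in order of decreasing length, and so are the bars of Q and N(d) with a common right end;
   the second case is the first one after the reflection t |-> d - t.  The required counts of bars
   are differences of ranks, and all comparisons between them are instances of
   dim f(A) - dim f(A') <= dim A - dim A' for A' a subspace of A.  Barcodes exist for every monotone
   supermodular rank function, in particular for that of Q, and the matching construction with
   shift 0 shows that they are unique. *)
theory Submission
  imports Defs
begin

section \<open>Dimensions of images\<close>

text \<open>No module is ever decomposed into interval modules: \<open>barcode\<close> is
  characterised by ranks alone, so the matchings must be read off from ranks as well. This works
  because only finitely many bars pass through a given point. The finitely many left ends that occur
  can then be separated by points, the number of bars with a given left end is an exact difference
  of two ranks, and no limits are taken.

  Factoring through Q lets each half of the matching keep one end fixed. Since g f is the transition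
  map of M by 2d, the kernel of M -> Q dies within 2d: a bar of Q has the left end of its partner in
  M and ends at most 2d earlier. Since f g is the transition map of N by 2d, a bar of N(d) has the
  right end of its partner in Q and begins at most 2d earlier. Undoing the shift by d turns these
  one-sided errors between 0 and 2d into errors of absolute value at most d.\<close>

definition fin_dim_subspace :: "('f::field \<Rightarrow> 'v::ab_group_add \<Rightarrow> 'v) \<Rightarrow> 'v set \<Rightarrow> bool" where
  "fin_dim_subspace s A \<longleftrightarrow> module.subspace s A \<and> (\<exists>B. finite B \<and> A \<subseteq> module.span s B)"

lemma lin_on_subset: "lin_on s1 s2 A f \<Longrightarrow> A' \<subseteq> A \<Longrightarrow> lin_on s1 s2 A' f"
  unfolding lin_on_def by blast

lemma lin_on_compose:
  assumes "lin_on s1 s2 A f" "f ` A \<subseteq> B" "lin_on s2 s3 B g"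
  shows "lin_on s1 s3 A (\<lambda>x. g (f x))"
  using assms unfolding lin_on_def by (simp add: image_subset_iff)

lemma lin_on_vimage_subspace:
  assumes "vector_space s1" "vector_space s2"
    and "module.subspace s1 A" "lin_on s1 s2 A f" "module.subspace s2 C"
  shows "module.subspace s1 {x \<in> A. f x \<in> C}"
proof -
  interpret V: vector_space s1 by fact
  interpret W: vector_space s2 by fact
  have "f (0 + 0) = f 0 + f 0"
    using assms(3,4) V.subspace_0 unfolding lin_on_def by blast
  then have "f 0 = 0" by simp
  then show ?thesis
    using assms(3,4,5)
    by (auto simp: V.subspace_def W.subspace_def lin_on_def)
qed

lemma lin_on_image_subspace:
  assumes "vector_space s1" "vector_space s2"
    and "module.subspace s1 A" "lin_on s1 s2 A f"
  shows "module.subspace s2 (f ` A)"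
proof -
  interpret V: vector_space s1 by fact
  interpret W: vector_space s2 by fact
  have "f (0 + 0) = f 0 + f 0"
    using assms(3,4) V.subspace_0 unfolding lin_on_def by blast
  then have f0: "f 0 = 0" by simp
  show ?thesis
  proof (rule W.subspaceI)
    show "0 \<in> f ` A" using f0 V.subspace_0[OF assms(3)] by force
    show "x + y \<in> f ` A" if xy: "x \<in> f ` A" "y \<in> f ` A" for x y
    proof -
      obtain a b where "a \<in> A" "b \<in> A" "x = f a" "y = f b" using xy by blast
      then show ?thesis
        using assms(4) V.subspace_add[OF assms(3)] unfolding lin_on_def by (metis imageI)
    qed
    show "s2 c x \<in> f ` A" if x: "x \<in> f ` A" for c x
    proof -
      obtain a where "a \<in> A" "x = f a" using x by blast
      then show ?thesis
        using assms(4) V.subspace_scale[OF assms(3)] unfolding lin_on_def by (metis imageI)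
    qed
  qed
qed

text \<open>The part of \<open>A\<close> that \<open>f\<close> maps into \<open>span C\<close> is a
  subspace; it contains \<open>B\<close>, hence \<open>span B\<close>, which contains
  \<open>A\<close>.\<close>

lemma lin_on_image_span:
  assumes "vector_space s1" "vector_space s2"
    and "module.subspace s1 A" "lin_on s1 s2 A f"
    and "B \<subseteq> A" "A \<subseteq> module.span s1 B" "f ` B \<subseteq> module.span s2 C"
  shows "f ` A \<subseteq> module.span s2 C"
proof -
  interpret V: vector_space s1 by fact
  interpret W: vector_space s2 by fact
  have "V.span B \<subseteq> {x \<in> A. f x \<in> W.span C}"
    using assms by (intro V.span_minimal lin_on_vimage_subspace) auto
  then show ?thesis using assms(6) by blast
qed

lemma fin_dim_subspace_basis:
  assumes "vector_space s" "fin_dim_subspace s A"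
  obtains B where "finite B" "B \<subseteq> A" "A \<subseteq> module.span s B" "card B = vector_space.dim s A"
proof -
  interpret V: vector_space s by fact
  obtain B0 where "finite B0" "A \<subseteq> V.span B0"
    using assms(2) unfolding fin_dim_subspace_def by blast
  moreover obtain B where B: "B \<subseteq> A" "V.independent B" "A \<subseteq> V.span B" "card B = V.dim A"
    using V.basis_exists by blast
  ultimately have "finite B"
    using V.independent_span_bound[of B0 B] by blast
  then show thesis using B that by blast
qed

lemma fin_dim_subspace_image:
  assumes "vector_space s1" "vector_space s2" "fin_dim_subspace s1 A" "lin_on s1 s2 A f"
  shows "fin_dim_subspace s2 (f ` A)"
proof -
  interpret V: vector_space s1 by fact
  interpret W: vector_space s2 by fact
  have sub: "V.subspace A" using assms(3) unfolding fin_dim_subspace_def by blast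
  obtain B where B: "finite B" "B \<subseteq> A" "A \<subseteq> V.span B"
    using fin_dim_subspace_basis[OF assms(1,3)] by metis
  have "f ` A \<subseteq> W.span (f ` B)"
    using lin_on_image_span[OF assms(1,2) sub assms(4) B(2,3)] W.span_superset by blast
  then show ?thesis
    unfolding fin_dim_subspace_def
    using lin_on_image_subspace[OF assms(1,2) sub assms(4)] B(1) by blast
qed

text \<open>\<open>f\<close> induces a surjection from A/A' onto f(A)/f(A'). In terms of bases: a
  basis \<open>B'\<close> of \<open>A'\<close> extends to a basis \<open>B\<close> of
  \<open>A\<close>, and f(A) is spanned by a basis of f(A') together with the images of
  \<open>B - B'\<close>. Dimensions are natural numbers, so both differences are written as
  sums.\<close>

lemma dim_image_diff_le:
  assumes "vector_space s1" "vector_space s2"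
    and A: "fin_dim_subspace s1 A" and A': "module.subspace s1 A'" "A' \<subseteq> A"
    and f: "lin_on s1 s2 A f"
  shows "vector_space.dim s2 (f ` A) + vector_space.dim s1 A'
       \<le> vector_space.dim s1 A + vector_space.dim s2 (f ` A')"
proof -
  interpret V: vector_space s1 by fact
  interpret W: vector_space s2 by fact
  have sub: "V.subspace A" using A unfolding fin_dim_subspace_def by blast
  obtain B0 where B0: "finite B0" "A \<subseteq> V.span B0"
    using A unfolding fin_dim_subspace_def by blast
  obtain B' where B': "B' \<subseteq> A'" "V.independent B'" "A' \<subseteq> V.span B'" "card B' = V.dim A'"
    using V.basis_exists by blast
  obtain B where B: "B' \<subseteq> B" "B \<subseteq> A" "V.independent B" "A \<subseteq> V.span B"
    using V.maximal_independent_subset_extend[OF _ B'(2), of A] B'(1) A'(2) by blast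
  have finB: "finite B" using V.independent_span_bound[OF B0(1) B(3)] B(2) B0(2) by blast
  have cardB: "card B = V.dim A" using V.basis_card_eq_dim[OF B(2,4,3)] by simp
  \<comment> \<open>The finite spanning set in \<open>fin_dim_subspace\<close> may lie outside the
    subspace, so the one for \<open>A\<close> serves for \<open>A'\<close>.\<close>
  have "fin_dim_subspace s1 A'"
    using A A' unfolding fin_dim_subspace_def by blast
  then have "fin_dim_subspace s2 (f ` A')"
    using fin_dim_subspace_image[OF assms(1,2)] lin_on_subset[OF f A'(2)] by blast
  then obtain C where C: "finite C" "C \<subseteq> f ` A'" "f ` A' \<subseteq> W.span C" "card C = W.dim (f ` A')"
    using fin_dim_subspace_basis[OF assms(2)] by metis
  have "f ` B \<subseteq> W.span (C \<union> f ` (B - B'))"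
  proof
    fix y assume "y \<in> f ` B"
    then consider "y \<in> f ` B'" | "y \<in> f ` (B - B')" by blast
    then show "y \<in> W.span (C \<union> f ` (B - B'))"
    proof cases
      case 1
      then have "y \<in> W.span C" using B'(1) C(3) by blast
      then show ?thesis using W.span_mono[of C "C \<union> f ` (B - B')"] by blast
    next
      case 2
      then show ?thesis by (simp add: W.span_base)
    qed
  qed
  then have "f ` A \<subseteq> W.span (C \<union> f ` (B - B'))"
    using lin_on_image_span[OF assms(1,2) sub f B(2,4)] by blast
  then have "W.dim (f ` A) \<le> card (C \<union> f ` (B - B'))"
    using C(1) finB by (intro W.dim_le_card) auto
  also have "\<dots> \<le> card C + card (f ` (B - B'))" by (rule card_Un_le)
  also have "\<dots> \<le> card C + card (B - B')" using finB by (simp add: card_image_le)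
  also have "card (B - B') = card B - card B'"
    using B(1) finB by (meson card_Diff_subset finite_subset)
  finally show ?thesis
    using C(4) cardB B'(4) card_mono[OF finB B(1)] by linarith
qed

lemma dim_image_le:
  assumes "vector_space s1" "vector_space s2"
    and "fin_dim_subspace s1 A" and "lin_on s1 s2 A f"
  shows "vector_space.dim s2 (f ` A) \<le> vector_space.dim s1 A"
proof -
  interpret V: vector_space s1 by fact
  interpret W: vector_space s2 by fact
  have "f 0 = f 0 + f 0"
    using assms(3,4) V.subspace_0 unfolding lin_on_def fin_dim_subspace_def by (metis add.right_neutral)
  then have f0: "f ` {0} = {0}" by simp
  have dim0: "V.dim {0} = 0" "W.dim {0} = 0"
    using V.dim_le_card[of "{0}" "{}"] W.dim_le_card[of "{0}" "{}"] by auto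
  show ?thesis
    using dim_image_diff_le[OF assms(1-3) _ _ assms(4), of "{0}"] assms(3) V.subspace_0
    unfolding f0 dim0 fin_dim_subspace_def by auto
qed

lemma dim_mono:
  assumes "vector_space s" and "fin_dim_subspace s A" "A' \<subseteq> A"
  shows "vector_space.dim s A' \<le> vector_space.dim s A"
proof -
  interpret V: vector_space s by fact
  obtain B where "finite B" "A \<subseteq> V.span B" "card B = V.dim A"
    using fin_dim_subspace_basis[OF assms(1,2)] by metis
  then show ?thesis using V.dim_le_card[of A' B] assms(3) by auto
qed

section \<open>Matching bars with a common left end\<close>

text \<open>An upset serves as the left end of an interval. Unlike \<open>lend\<close> it
  distinguishes [0, 1] from (0, 1], and \<open>UNIV\<close> is the left end at minus
  infinity.\<close>

definition up_closure :: "real set \<Rightarrow> real set" where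
  "up_closure I = {x. \<exists>y\<in>I. y \<le> x}"

definition upset :: "real set \<Rightarrow> bool" where
  "upset U \<longleftrightarrow> (\<forall>x\<in>U. \<forall>y\<ge>x. y \<in> U)"

lemma upset_up_closure [simp]: "upset (up_closure I)"
  unfolding upset_def up_closure_def using order_trans by blast

lemma subset_up_closure: "I \<subseteq> up_closure I"
  unfolding up_closure_def by auto

lemma mem_interval_iff_up_closure:
  "real_interval I \<Longrightarrow> t \<in> I \<Longrightarrow> x \<le> t \<Longrightarrow> x \<in> I \<longleftrightarrow> x \<in> up_closure I"
  unfolding real_interval_def up_closure_def by blast

text \<open>Bars with the same left end can only differ on the right, so inclusion orders them
  totally. This gives a meaning to decreasing length even for infinite bars and for bars that differ
  in an end point only.\<close>

lemma interval_comparable: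
  assumes "real_interval I" "real_interval J" "up_closure I = up_closure J"
  shows "I \<subseteq> J \<or> J \<subseteq> I"
proof (rule ccontr)
  assume "\<not> ?thesis"
  then obtain x y where xy: "x \<in> I" "x \<notin> J" "y \<in> J" "y \<notin> I" by blast
  show False
  proof (cases "x \<le> y")
    case True
    then show ?thesis
      using xy assms mem_interval_iff_up_closure[of J y x] subset_up_closure[of I] by blast
  next
    case False
    then show ?thesis
      using xy assms mem_interval_iff_up_closure[of I x y] subset_up_closure[of J] by force
  qed
qed

text \<open>Each member of \<open>F\<close> that does not contain \<open>U\<close> misses a point of
  \<open>U\<close>; the minimum of \<open>t\<close> and finitely many such points lies outside all
  of them. Thus \<open>x\<close> lies before every left end in \<open>F\<close> that is later than
  \<open>U\<close>.\<close>

lemma separate_upsets_below: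
  assumes "finite F" "\<forall>V\<in>F. upset V" "upset U" "t \<in> U"
  shows "\<exists>x\<in>U. x \<le> t \<and> (\<forall>V\<in>F. x \<in> V \<longrightarrow> U \<subseteq> V)"
  using assms(1,2)
proof (induction F rule: finite_induct)
  case empty
  then show ?case using assms(4) by auto
next
  case (insert V F)
  then obtain x where x: "x \<in> U" "x \<le> t" "\<forall>V\<in>F. x \<in> V \<longrightarrow> U \<subseteq> V" by auto
  show ?case
  proof (cases "U \<subseteq> V")
    case True
    then show ?thesis using x by auto
  next
    case False
    then obtain y where y: "y \<in> U" "y \<notin> V" by blast
    have "min x y \<notin> V" using y insert.prems unfolding upset_def by (metis insertI1 min.cobounded2)
    moreover have "min x y \<in> W \<longrightarrow> U \<subseteq> W" if "W \<in> F" for W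
      using that x(3) insert.prems unfolding upset_def by (metis insertI2 min.cobounded1)
    moreover have "min x y \<in> U" using x y by (simp add: min_def)
    moreover have "min x y \<le> t" using x by auto
    ultimately show ?thesis by blast
  qed
qed

text \<open>Here the maximum of finitely many points, taken from the sets \<open>V - U\<close>, lies
  after every left end in \<open>F\<close> that is earlier than \<open>U\<close>. Together with the
  point from \<open>separate_upsets_below\<close> it singles out \<open>U\<close> within
  \<open>F\<close>.\<close>

lemma separate_upsets_above:
  assumes "finite F" "\<forall>V\<in>F. upset V" "upset U" "U \<noteq> UNIV"
  shows "\<exists>x. x \<notin> U \<and> (\<forall>V\<in>F. x \<notin> V \<longrightarrow> V \<subseteq> U)"
  using assms(1,2)
proof (induction F rule: finite_induct)
  case empty
  then show ?case using assms(4) by auto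
next
  case (insert V F)
  then obtain x where x: "x \<notin> U" "\<forall>V\<in>F. x \<notin> V \<longrightarrow> V \<subseteq> U" by auto
  show ?case
  proof (cases "V \<subseteq> U")
    case True
    then show ?thesis using x by auto
  next
    case False
    then obtain y where y: "y \<in> V" "y \<notin> U" by blast
    have "max x y \<in> V" using y insert.prems unfolding upset_def by (metis insertI1 max.cobounded2)
    moreover have "max x y \<notin> W \<longrightarrow> W \<subseteq> U" if "W \<in> F" for W
      using that x(2) insert.prems unfolding upset_def by (metis insertI2 max.cobounded1)
    moreover have "max x y \<notin> U" using x y by (simp add: max_def)
    ultimately show ?thesis by blast
  qed
qed

section \<open>Counting bars by ranks\<close>

lemma mset_elems_interval:
  "is_barcode_of_rank r b \<Longrightarrow> e \<in> mset_elems b \<Longrightarrow> real_interval (fst e)"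
  unfolding is_barcode_of_rank_def mset_elems_def by fastforce

lemma mset_elems_card:
  assumes "is_barcode_of_rank r b" "s \<le> t"
  shows "finite {e \<in> mset_elems b. s \<in> fst e \<and> t \<in> fst e}"
    and "card {e \<in> mset_elems b. s \<in> fst e \<and> t \<in> fst e} = r s t"
proof -
  let ?S = "{I. b I > 0 \<and> s \<in> I \<and> t \<in> I}"
  have eq: "{e \<in> mset_elems b. s \<in> fst e \<and> t \<in> fst e} = (SIGMA I:?S. {..<b I})"
    unfolding mset_elems_def by auto
  have S: "finite ?S" "r s t = (\<Sum>I\<in>?S. b I)"
    using assms unfolding is_barcode_of_rank_def by blast+
  show "finite {e \<in> mset_elems b. s \<in> fst e \<and> t \<in> fst e}"
    unfolding eq using S(1) by blast
  show "card {e \<in> mset_elems b. s \<in> fst e \<and> t \<in> fst e} = r s t"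
    unfolding eq using S by simp
qed

definition bars_from :: "(real set \<Rightarrow> nat) \<Rightarrow> real set \<Rightarrow> real \<Rightarrow> (real set \<times> nat) set" where
  "bars_from b U t = {e \<in> mset_elems b. up_closure (fst e) = U \<and> t \<in> fst e}"

lemma finite_bars_from: "is_barcode_of_rank r b \<Longrightarrow> finite (bars_from b U t)"
  by (rule finite_subset[OF _ mset_elems_card(1)[of r b t t]]) (auto simp: bars_from_def)

text \<open>A left end at minus infinity has no point before it, so here a single rank takes the
  place of a difference of ranks.\<close>

lemma bars_from_whole:
  assumes b: "is_barcode_of_rank r b" and "x \<le> t"
    and sep: "\<forall>e\<in>mset_elems b. t \<in> fst e \<longrightarrow> x \<in> up_closure (fst e) \<longrightarrow> up_closure (fst e) = UNIV"
  shows "card (bars_from b UNIV t) = r x t"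
proof -
  have "bars_from b UNIV t = {e \<in> mset_elems b. x \<in> fst e \<and> t \<in> fst e}"
    using sep mset_elems_interval[OF b] mem_interval_iff_up_closure \<open>x \<le> t\<close>
    unfolding bars_from_def by blast
  then show ?thesis using mset_elems_card(2)[OF b \<open>x \<le> t\<close>] by simp
qed

text \<open>With \<open>x\<close> just after and \<open>x'\<close> just before the left end
  \<open>U\<close>, a bar through \<open>t\<close> begins at \<open>U\<close> exactly if it contains
  \<open>x\<close> but not \<open>x'\<close>.\<close>

lemma bars_from_card:
  assumes b: "is_barcode_of_rank r b" and U: "upset U" "x \<in> U" "x' \<notin> U" and "x \<le> t"
    and sep: "\<forall>e\<in>mset_elems b. t \<in> fst e \<longrightarrow> x \<in> up_closure (fst e) \<longrightarrow> U \<subseteq> up_closure (fst e)"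
    and sep': "\<forall>e\<in>mset_elems b. t \<in> fst e \<longrightarrow> x' \<notin> up_closure (fst e) \<longrightarrow> up_closure (fst e) \<subseteq> U"
  shows "card (bars_from b U t) + r x' t = r x t"
proof -
  have "x' \<le> x" using U unfolding upset_def by (meson linear)
  let ?X = "{e \<in> mset_elems b. x \<in> fst e \<and> t \<in> fst e}"
  let ?X' = "{e \<in> mset_elems b. x' \<in> fst e \<and> t \<in> fst e}"
  have sub: "?X' \<subseteq> ?X"
    using \<open>x' \<le> x\<close> \<open>x \<le> t\<close> mset_elems_interval[OF b] unfolding real_interval_def by blast
  have iff: "x \<in> fst e \<longleftrightarrow> x \<in> up_closure (fst e)" "x' \<in> fst e \<longleftrightarrow> x' \<in> up_closure (fst e)"
    if "e \<in> mset_elems b" "t \<in> fst e" for e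
    using mem_interval_iff_up_closure[OF mset_elems_interval[OF b that(1)] that(2)]
      \<open>x' \<le> x\<close> \<open>x \<le> t\<close> by auto
  have "bars_from b U t = ?X - ?X'"
    using iff sep sep' U unfolding bars_from_def by blast
  then show ?thesis
    using card_Diff_subset[of ?X' ?X] sub mset_elems_card[OF b, of x t] mset_elems_card[OF b, of x' t]
      \<open>x' \<le> x\<close> \<open>x \<le> t\<close> card_mono[OF _ sub] by auto
qed

text \<open>\<open>le\<close> settles the bars unbounded on the left, whose number is one rank, and
  \<open>diff\<close> all others, whose number is a difference of two ranks. The points
  \<open>t\<close> and \<open>u\<close> are independent of each other so that one barcode at
  \<open>t + \<eta>\<close> can be compared with another at \<open>t\<close>.\<close>

lemma bars_from_card_le:
  assumes b: "is_barcode_of_rank r b" and c: "is_barcode_of_rank q c"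
    and U: "upset U" "t \<in> U" "u \<in> U"
    and le: "\<And>s. s \<le> t \<Longrightarrow> s \<le> u \<Longrightarrow> r s t \<le> q s u"
    and diff: "\<And>s' s. s' \<le> s \<Longrightarrow> s \<le> t \<Longrightarrow> s \<le> u \<Longrightarrow> r s t + q s' u \<le> q s u + r s' t"
  shows "card (bars_from b U t) \<le> card (bars_from c U u)"
proof -
  \<comment> \<open>The left ends of both barcodes are collected, so that the same points
    \<open>x\<close> and \<open>x'\<close> separate \<open>U\<close> in \<open>b\<close> and in
    \<open>c\<close>.\<close>
  define F where "F = (\<lambda>e. up_closure (fst e)) `
    ({e \<in> mset_elems b. t \<in> fst e \<and> t \<in> fst e} \<union> {e \<in> mset_elems c. u \<in> fst e \<and> u \<in> fst e})"
  have F: "finite F" "\<forall>V\<in>F. upset V"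
    unfolding F_def using mset_elems_card(1)[OF b order_refl] mset_elems_card(1)[OF c order_refl]
    by (blast intro: upset_up_closure)+
  have "min t u \<in> U" using U by (simp add: min_def)
  then obtain x where x: "x \<in> U" "x \<le> min t u" "\<forall>V\<in>F. x \<in> V \<longrightarrow> U \<subseteq> V"
    using separate_upsets_below[OF F U(1)] by blast
  then have xtu: "x \<le> t" "x \<le> u" by auto
  show ?thesis
  proof (cases "U = UNIV")
    case True
    have "card (bars_from b U t) = r x t" "card (bars_from c U u) = q x u"
      using bars_from_whole[OF b xtu(1)] bars_from_whole[OF c xtu(2)] x(3) True
      unfolding F_def by auto
    then show ?thesis using le[OF xtu] by simp
  next
    case False
    obtain x' where x': "x' \<notin> U" "\<forall>V\<in>F. x' \<notin> V \<longrightarrow> V \<subseteq> U"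
      using separate_upsets_above[OF F U(1) False] by blast
    have "x' \<le> x" using U(1) x(1) x'(1) unfolding upset_def by (meson linear)
    moreover have "card (bars_from b U t) + r x' t = r x t"
      using x(3) x'(2) unfolding F_def by (intro bars_from_card[OF b U(1) x(1) x'(1) xtu(1)]) auto
    moreover have "card (bars_from c U u) + q x' u = q x u"
      using x(3) x'(2) unfolding F_def by (intro bars_from_card[OF c U(1) x(1) x'(1) xtu(2)]) auto
    ultimately show ?thesis using diff[OF _ xtu, of x'] by fastforce
  qed
qed

text \<open>The cardinality of this set is the position of e when the bars with the same left end are
  listed by decreasing length, the second component breaking ties.\<close>
definition longer_bars :: "(real set \<Rightarrow> nat) \<Rightarrow> real set \<times> nat \<Rightarrow> (real set \<times> nat) set" where
  "longer_bars b e = {e' \<in> mset_elems b. up_closure (fst e') = up_closure (fst e) \<and>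
     (fst e \<subset> fst e' \<or> fst e' = fst e \<and> snd e' < snd e)}"

lemma finite_longer_bars:
  assumes "is_barcode_of_rank r b" "e \<in> mset_elems b"
  shows "finite (longer_bars b e)"
proof -
  obtain t where "t \<in> fst e"
    using mset_elems_interval[OF assms] unfolding real_interval_def by blast
  then have "longer_bars b e \<subseteq> bars_from b (up_closure (fst e)) t"
    unfolding longer_bars_def bars_from_def by auto
  then show ?thesis using finite_bars_from[OF assms(1)] finite_subset by blast
qed

lemma longer_bars_less:
  assumes b: "is_barcode_of_rank r b" and "e \<in> mset_elems b" "e' \<in> longer_bars b e"
  shows "card (longer_bars b e') < card (longer_bars b e)"
proof (rule psubset_card_mono)
  show "finite (longer_bars b e)" using finite_longer_bars assms(1,2) .
  have "longer_bars b e' \<subseteq> longer_bars b e"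
    using assms(3) unfolding longer_bars_def by (auto 4 3)
  moreover have "e' \<notin> longer_bars b e'" unfolding longer_bars_def by auto
  ultimately show "longer_bars b e' \<subset> longer_bars b e" using assms(3) by blast
qed

lemma longer_bars_linear:
  assumes b: "is_barcode_of_rank r b" and "e \<in> mset_elems b" "e' \<in> mset_elems b"
    and "up_closure (fst e) = up_closure (fst e')" "e \<noteq> e'"
  shows "e' \<in> longer_bars b e \<or> e \<in> longer_bars b e'"
proof (cases "fst e = fst e'")
  case True
  then have "snd e < snd e' \<or> snd e' < snd e" using assms(5) by (simp add: prod_eq_iff) linarith
  then show ?thesis using True assms unfolding longer_bars_def by auto
next
  case False
  have "fst e \<subseteq> fst e' \<or> fst e' \<subseteq> fst e"
    using interval_comparable mset_elems_interval[OF b] assms by blast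
  then have "fst e \<subset> fst e' \<or> fst e' \<subset> fst e" using False by blast
  then show ?thesis using assms unfolding longer_bars_def by auto
qed

lemma longer_bars_inj:
  assumes "is_barcode_of_rank r b" "e \<in> mset_elems b" "e' \<in> mset_elems b"
    and "up_closure (fst e) = up_closure (fst e')"
    and "card (longer_bars b e) = card (longer_bars b e')"
  shows "e = e'"
proof (rule ccontr)
  assume "e \<noteq> e'"
  then consider "e' \<in> longer_bars b e" | "e \<in> longer_bars b e'"
    using longer_bars_linear[OF assms(1-4)] by blast
  then show False
    using longer_bars_less[OF assms(1,2), of e'] longer_bars_less[OF assms(1,3), of e] assms(5)
    by cases auto
qed

text \<open>Bars ahead of a bar through \<open>t\<close> with the same left end contain
  \<open>t\<close> too, so its position is below the number of such bars. Positions are distinct,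
  hence they fill this range.\<close>

lemma longer_bars_image:
  assumes b: "is_barcode_of_rank r b"
  shows "(\<lambda>e. card (longer_bars b e)) ` bars_from b U t = {..<card (bars_from b U t)}"
proof (rule card_subset_eq)
  let ?A = "bars_from b U t" and ?\<sigma> = "\<lambda>e. card (longer_bars b e)"
  show "?\<sigma> ` ?A \<subseteq> {..<card ?A}"
  proof clarify
    fix e assume e: "e \<in> ?A"
    then have "longer_bars b e \<subset> ?A"
      unfolding longer_bars_def bars_from_def by auto
    then show "?\<sigma> e < card ?A" using finite_bars_from[OF b] psubset_card_mono by blast
  qed
  have "inj_on ?\<sigma> ?A"
    using longer_bars_inj[OF b] unfolding inj_on_def bars_from_def by blast
  then show "card (?\<sigma> ` ?A) = card {..<card ?A}" by (simp add: card_image)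
qed simp

lemma bar_at_position:
  assumes "is_barcode_of_rank r b" "k < card (bars_from b U t)"
  obtains e where "e \<in> bars_from b U t" "card (longer_bars b e) = k"
proof -
  have "k \<in> (\<lambda>e. card (longer_bars b e)) ` bars_from b U t"
    unfolding longer_bars_image[OF assms(1)] using assms(2) by simp
  then show thesis using that by blast
qed

text \<open>The bars through \<open>t\<close> occupy exactly the first positions, so membership
  becomes a comparison of a position with a count. Matched bars have equal positions; inclusions
  between them thereby reduce to inequalities between counts.\<close>

lemma mem_bar_iff:
  assumes b: "is_barcode_of_rank r b" and e: "e \<in> mset_elems b"
  shows "t \<in> fst e \<longleftrightarrow> card (longer_bars b e) < card (bars_from b (up_closure (fst e)) t)"
proof
  assume "t \<in> fst e"
  then have "e \<in> bars_from b (up_closure (fst e)) t" using e unfolding bars_from_def by simp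
  from imageI[OF this, of "\<lambda>e. card (longer_bars b e)"]
  show "card (longer_bars b e) < card (bars_from b (up_closure (fst e)) t)"
    unfolding longer_bars_image[OF b] by simp
next
  assume "card (longer_bars b e) < card (bars_from b (up_closure (fst e)) t)"
  then obtain e' where e': "e' \<in> bars_from b (up_closure (fst e)) t"
      "card (longer_bars b e') = card (longer_bars b e)"
    by (rule bar_at_position[OF b])
  then have "e' = e" using longer_bars_inj[OF b _ e, of e'] unfolding bars_from_def by simp
  then show "t \<in> fst e" using e' unfolding bars_from_def by simp
qed

section \<open>The matching by position and its properties\<close>

definition left_matching ::
  "(real set \<Rightarrow> nat) \<Rightarrow> (real set \<Rightarrow> nat) \<Rightarrow> ((real set \<times> nat) \<times> (real set \<times> nat)) set" where
  "left_matching b c = {(x, y). x \<in> mset_elems b \<and> y \<in> mset_elems c \<and>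
     up_closure (fst x) = up_closure (fst y) \<and> card (longer_bars b x) = card (longer_bars c y)}"

lemma left_matching_partial:
  assumes "is_barcode_of_rank r b" "is_barcode_of_rank q c"
  shows "partial_matching b c (left_matching b c)"
  unfolding partial_matching_def
proof (intro conjI allI impI)
  show "left_matching b c \<subseteq> mset_elems b \<times> mset_elems c"
    unfolding left_matching_def by auto
  show "y = y'" if "(x, y) \<in> left_matching b c" "(x, y') \<in> left_matching b c" for x y y'
    using that by (intro longer_bars_inj[OF assms(2)]) (simp_all add: left_matching_def)
  show "x = x'" if "(x, y) \<in> left_matching b c" "(x', y) \<in> left_matching b c" for x x' y
    using that by (intro longer_bars_inj[OF assms(1)]) (simp_all add: left_matching_def)
qed

text \<open>The model case: \<open>r\<close> belongs to a persistence space and \<open>q\<close> to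
  a quotient of it whose kernel vanishes after time \<open>\<eta>\<close>. \<open>le\<close> and
  \<open>diff\<close> express the surjection onto the quotient, \<open>le'\<close> and
  \<open>diff'\<close> that the transition map from \<open>t\<close> to \<open>t + \<eta>\<close>
  factors through it. In each pair the first inequality governs the bars unbounded on the left and
  the second one the others.\<close>

locale left_domination =
  fixes r q :: "real \<Rightarrow> real \<Rightarrow> nat" and b c :: "real set \<Rightarrow> nat" and \<eta> :: real
  assumes r: "is_barcode_of_rank r b" and q: "is_barcode_of_rank q c" and \<eta>: "\<eta> \<ge> 0"
    and le: "\<And>s t. s \<le> t \<Longrightarrow> q s t \<le> r s t"
    and diff: "\<And>s' s t. s' \<le> s \<Longrightarrow> s \<le> t \<Longrightarrow> q s t + r s' t \<le> r s t + q s' t"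
    and le': "\<And>s t. s \<le> t \<Longrightarrow> r s (t + \<eta>) \<le> q s t"
    and diff': "\<And>s' s t. s' \<le> s \<Longrightarrow> s \<le> t \<Longrightarrow> r s (t + \<eta>) + q s' t \<le> q s t + r s' (t + \<eta>)"
begin

lemma card_le: "upset U \<Longrightarrow> t \<in> U \<Longrightarrow> card (bars_from c U t) \<le> card (bars_from b U t)"
  by (rule bars_from_card_le[OF q r]; (rule le diff)?; assumption)

lemma card_le':
  assumes "upset U" "t \<in> U"
  shows "card (bars_from b U (t + \<eta>)) \<le> card (bars_from c U t)"
proof -
  have "t \<le> t + \<eta>" using \<eta> by simp
  then have "t + \<eta> \<in> U" using assms unfolding upset_def by blast
  from bars_from_card_le[OF r q assms(1) this assms(2)] show ?thesis
    using le' diff' by blast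
qed

lemma matched_subset:
  assumes "(x, y) \<in> left_matching b c"
  shows "fst y \<subseteq> fst x"
proof
  fix t assume t: "t \<in> fst y"
  have xy: "x \<in> mset_elems b" "y \<in> mset_elems c" "up_closure (fst x) = up_closure (fst y)"
    "card (longer_bars b x) = card (longer_bars c y)"
    using assms unfolding left_matching_def by auto
  have "card (bars_from c (up_closure (fst y)) t) \<le> card (bars_from b (up_closure (fst y)) t)"
    using t subset_up_closure by (intro card_le) auto
  then show "t \<in> fst x"
    using t unfolding mem_bar_iff[OF r xy(1)] mem_bar_iff[OF q xy(2)] xy(3,4) by linarith
qed

text \<open>The partner in \<open>c\<close> may end earlier than \<open>x\<close>, but by at most
  \<open>\<eta>\<close>. The condition on \<open>up_closure\<close> keeps \<open>t\<close> from
  lying before the common left end.\<close>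

lemma matched_subset':
  assumes "(x, y) \<in> left_matching b c" "t \<in> up_closure (fst x)" "t + \<eta> \<in> fst x"
  shows "t \<in> fst y"
proof -
  have xy: "x \<in> mset_elems b" "y \<in> mset_elems c" "up_closure (fst x) = up_closure (fst y)"
    "card (longer_bars b x) = card (longer_bars c y)"
    using assms unfolding left_matching_def by auto
  have "card (bars_from b (up_closure (fst y)) (t + \<eta>)) \<le> card (bars_from c (up_closure (fst y)) t)"
    using assms(2) xy(3) by (intro card_le') auto
  then show ?thesis
    using assms(3) unfolding mem_bar_iff[OF r xy(1)] mem_bar_iff[OF q xy(2)] xy(3,4) by linarith
qed

text \<open>The position of \<open>y\<close> is below the number of bars of \<open>c\<close> through
  a point of \<open>y\<close>, hence below that number for \<open>b\<close>, so \<open>b\<close> has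
  a bar at this position.\<close>

lemma all_targets_matched:
  assumes "y \<in> mset_elems c"
  shows "y \<in> Range (left_matching b c)"
proof -
  obtain t where t: "t \<in> fst y"
    using mset_elems_interval[OF q assms] unfolding real_interval_def by blast
  let ?U = "up_closure (fst y)"
  have "card (bars_from c ?U t) \<le> card (bars_from b ?U t)"
    using t subset_up_closure by (intro card_le) auto
  then have "card (longer_bars c y) < card (bars_from b ?U t)"
    using t unfolding mem_bar_iff[OF q assms] by linarith
  then obtain x where "x \<in> bars_from b ?U t" "card (longer_bars b x) = card (longer_bars c y)"
    by (rule bar_at_position[OF r])
  then show ?thesis using assms unfolding left_matching_def bars_from_def by blast
qed

lemma long_bars_matched:
  assumes "x \<in> mset_elems b" "t \<in> fst x" "t + \<eta> \<in> fst x"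
  shows "x \<in> Domain (left_matching b c)"
proof -
  let ?U = "up_closure (fst x)"
  have "card (bars_from b ?U (t + \<eta>)) \<le> card (bars_from c ?U t)"
    using assms(2) subset_up_closure by (intro card_le') auto
  then have "card (longer_bars b x) < card (bars_from c ?U t)"
    using assms(3) unfolding mem_bar_iff[OF r assms(1)] by linarith
  then obtain y where "y \<in> bars_from c ?U t" "card (longer_bars c y) = card (longer_bars b x)"
    by (rule bar_at_position[OF q])
  then have "(x, y) \<in> left_matching b c"
    using assms(1) unfolding left_matching_def bars_from_def by simp
  then show ?thesis by blast
qed

end

text \<open>With equal rank functions and \<open>\<eta> = 0\<close> the inequalities of
  \<open>left_domination\<close> are trivial, every bar is long enough to be matched, and matched
  bars coincide. The matching therefore sends the copies of \<open>I\<close> in \<open>b\<close>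
  injectively to copies of \<open>I\<close> in \<open>c\<close>.\<close>

lemma barcode_unique_le:
  assumes b: "is_barcode_of_rank r b" and c: "is_barcode_of_rank r c"
  shows "b I \<le> c I"
proof -
  interpret left_domination r r b c 0
    by unfold_locales (use b c in auto)
  have eq: "fst x = fst y" if "(x, y) \<in> left_matching b c" for x y
    using matched_subset[OF that] matched_subset'[OF that] subset_up_closure[of "fst x"] by auto
  have "\<exists>j. ((I, k), (I, j)) \<in> left_matching b c" if k: "k < b I" for k
  proof -
    have x: "(I, k) \<in> mset_elems b" using k unfolding mset_elems_def by simp
    obtain t where "t \<in> I"
      using mset_elems_interval[OF b x] unfolding real_interval_def by auto
    then obtain y where y: "((I, k), y) \<in> left_matching b c"
      using long_bars_matched[OF x, of t] by auto
    then show ?thesis using eq[OF y] by (metis fst_conv prod.collapse)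
  qed
  then obtain f where f: "\<And>k. k < b I \<Longrightarrow> ((I, k), (I, f k)) \<in> left_matching b c"
    by metis
  have pm: "partial_matching b c (left_matching b c)" using left_matching_partial[OF b c] .
  have "inj_on f {..<b I}"
  proof (rule inj_onI)
    fix k k' assume "k \<in> {..<b I}" "k' \<in> {..<b I}" "f k = f k'"
    then have "((I, k), (I, f k)) \<in> left_matching b c" "((I, k'), (I, f k)) \<in> left_matching b c"
      using f[of k] f[of k'] by auto
    then show "k = k'" using pm unfolding partial_matching_def by blast
  qed
  moreover have "f ` {..<b I} \<subseteq> {..<c I}"
  proof clarify
    fix k assume "k < b I"
    then have "(I, f k) \<in> mset_elems c" using f unfolding left_matching_def by blast
    then show "f k < c I" unfolding mset_elems_def by simp
  qed
  ultimately show ?thesis using card_inj_on_le[of f "{..<b I}" "{..<c I}"] by simp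
qed

lemma barcode_unique:
  "is_barcode_of_rank r b \<Longrightarrow> is_barcode_of_rank r c \<Longrightarrow> b = c"
  by (rule ext) (simp add: antisym barcode_unique_le)

section \<open>Existence of barcodes\<close>

text \<open>For a barcode, \<open>r s t + r s' t' - r s t' - r s' t\<close> is the number of bars
  that contain \<open>s\<close> and \<open>t\<close> but neither \<open>s'\<close> nor
  \<open>t'\<close>. Supermodularity says that this number is not negative.\<close>

locale rank_function =
  fixes r :: "real \<Rightarrow> real \<Rightarrow> nat"
  assumes mono: "\<And>s' s t. s' \<le> s \<Longrightarrow> s \<le> t \<Longrightarrow> r s' t \<le> r s t"
    and mono_right: "\<And>s t t'. s \<le> t \<Longrightarrow> t \<le> t' \<Longrightarrow> r s t' \<le> r s t"
    and supermodular: "\<And>s' s t t'. s' \<le> s \<Longrightarrow> s \<le> t \<Longrightarrow> t \<le> t' \<Longrightarrow>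
      r s t' + r s' t \<le> r s t + r s' t'"
begin

text \<open>The left end (as an upset) of the i-th longest bar through t, bars being compared by their
  left ends.\<close>
definition birth :: "real \<Rightarrow> nat \<Rightarrow> real set" where
  "birth t i = up_closure {x. x \<le> t \<and> i < r x t}"

definition mult :: "real set \<Rightarrow> real \<Rightarrow> nat" where
  "mult U t = card {i. i < r t t \<and> birth t i = U}"

text \<open>This is a conjugate partition: \<open>mult U t\<close> is to count the bars that begin
  at \<open>U\<close> and reach \<open>t\<close>, and the bar of index \<open>i\<close> consists of
  the times at which more than \<open>i\<close> of them are left.\<close>

definition bar :: "real set \<Rightarrow> nat \<Rightarrow> real set" where
  "bar U i = {t \<in> U. i < mult U t}"

definition bars :: "real set \<Rightarrow> nat" where
  "bars I = (if real_interval I then card {i. bar (up_closure I) i = I} else 0)"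

lemma mem_birth:
  assumes "x \<le> t"
  shows "x \<in> birth t i \<longleftrightarrow> i < r x t"
proof
  assume "x \<in> birth t i"
  then obtain y where "y \<le> x" "i < r y t" unfolding birth_def up_closure_def by blast
  then show "i < r x t" using mono[OF _ assms, of y] by simp
next
  assume "i < r x t"
  then show "x \<in> birth t i"
    using assms subset_up_closure[of "{x. x \<le> t \<and> i < r x t}"] unfolding birth_def by blast
qed

lemma upset_birth: "upset (birth t i)"
  unfolding birth_def by simp

text \<open>For points \<open>x\<close> and \<open>x'\<close> on either side of the left end, chosen
  for the times \<open>t\<close> and \<open>t'\<close> together, \<open>mult U u\<close> is
  \<open>r x u - r x' u\<close>; by supermodularity this difference does not increase with time. For
  \<open>U = UNIV\<close> it is the single rank \<open>r x u\<close>, and \<open>mono_right\<close>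
  applies.\<close>

lemma mult_antimono:
  assumes U: "upset U" "t \<in> U" and "t \<le> t'"
  shows "mult U t' \<le> mult U t"
proof -
  define F where "F = birth t ` {..<r t t} \<union> birth t' ` {..<r t' t'}"
  have F: "finite F" "\<forall>V\<in>F. upset V"
    unfolding F_def using upset_birth by auto
  obtain x where x: "x \<in> U" "x \<le> t" "\<forall>V\<in>F. x \<in> V \<longrightarrow> U \<subseteq> V"
    using separate_upsets_below[OF F U] by blast
  have bound: "i < r u u" if "i < r x u" "u \<in> {t, t'}" for i u
    using that mono[of x u u] x(2) \<open>t \<le> t'\<close> by auto
  show ?thesis
  proof (cases "U = UNIV")
    case True
    have "mult U u = r x u" if u: "u \<in> {t, t'}" for u
    proof -
      have xu: "x \<le> u" using u x(2) \<open>t \<le> t'\<close> by auto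
      have "{i. i < r u u \<and> birth u i = U} = {..<r x u}"
        using x(3) True u bound[OF _ u] mem_birth[OF xu] unfolding F_def by blast
      then show ?thesis unfolding mult_def by simp
    qed
    then show ?thesis using mono_right[OF x(2) \<open>t \<le> t'\<close>] by simp
  next
    case False
    obtain x' where x': "x' \<notin> U" "\<forall>V\<in>F. x' \<notin> V \<longrightarrow> V \<subseteq> U"
      using separate_upsets_above[OF F U(1) False] by blast
    have x'x: "x' \<le> x" using U(1) x(1) x'(1) unfolding upset_def by (meson linear)
    have "mult U u = r x u - r x' u" if u: "u \<in> {t, t'}" for u
    proof -
      have xu: "x \<le> u" "x' \<le> u" using u x(2) x'x \<open>t \<le> t'\<close> by auto
      have "birth u i = U \<longleftrightarrow> r x' u \<le> i \<and> i < r x u" if "i < r u u" for i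
      proof -
        have "birth u i \<in> F" using that u unfolding F_def by auto
        then have "birth u i = U \<longleftrightarrow> x' \<notin> birth u i \<and> x \<in> birth u i"
          using x(1,3) x' by blast
        then show ?thesis using mem_birth xu by auto
      qed
      then have "{i. i < r u u \<and> birth u i = U} = {r x' u..<r x u}"
        using bound[OF _ u] by fastforce
      then show ?thesis unfolding mult_def by simp
    qed
    then show ?thesis
      using supermodular[OF x'x x(2) \<open>t \<le> t'\<close>] mono[OF x'x x(2)] by simp
  qed
qed

text \<open>Counts only grow towards the left end, so a bar that reaches \<open>t\<close> contains
  every point of \<open>U\<close> before \<open>t\<close>.\<close>

lemma up_closure_bar:
  assumes "upset U" "t \<in> bar U i"
  shows "up_closure (bar U i) = U"
proof
  show "up_closure (bar U i) \<subseteq> U"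
    using assms(1) unfolding up_closure_def bar_def upset_def by auto
  show "U \<subseteq> up_closure (bar U i)"
  proof
    fix x assume x: "x \<in> U"
    have t: "t \<in> U" "i < mult U t" using assms(2) unfolding bar_def by auto
    have "min x t \<in> U" using x t by (simp add: min_def)
    then have "min x t \<in> bar U i"
      using t mult_antimono[OF assms(1), of "min x t" t] unfolding bar_def by auto
    then show "x \<in> up_closure (bar U i)"
      unfolding up_closure_def by (auto intro: bexI[of _ "min x t"])
  qed
qed

lemma real_interval_bar:
  assumes "upset U" "t \<in> bar U i"
  shows "real_interval (bar U i)"
  unfolding real_interval_def
proof (intro conjI ballI allI impI)
  fix x y z assume "x \<in> bar U i" "z \<in> bar U i" "x \<le> y \<and> y \<le> z"
  moreover from this have "y \<in> U" using assms(1) unfolding upset_def bar_def by blast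
  ultimately show "y \<in> bar U i"
    using mult_antimono[OF assms(1), of y z] unfolding bar_def by auto
qed (use assms in auto)

lemma finite_bars_index:
  assumes "real_interval I"
  shows "finite {i. bar (up_closure I) i = I}"
proof -
  obtain t where "t \<in> I" using assms unfolding real_interval_def by blast
  then have "{i. bar (up_closure I) i = I} \<subseteq> {..<mult (up_closure I) t}"
    unfolding bar_def by auto
  then show ?thesis using finite_subset by blast
qed

text \<open>By \<open>mem_birth\<close>, an index is below \<open>r s t\<close> exactly if its birth
  contains \<open>s\<close>. Grouping these indices by birth therefore yields full fibres of
  \<open>birth t\<close>, whose sizes are the values of \<open>mult\<close>.\<close>

lemma sum_mult:
  assumes "s \<le> t"
  shows "(\<Sum>U\<in>birth t ` {..<r s t}. mult U t) = r s t"
proof -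
  have "card (\<Union>U\<in>birth t ` {..<r s t}. {i. i < r t t \<and> birth t i = U})
      = (\<Sum>U\<in>birth t ` {..<r s t}. card {i. i < r t t \<and> birth t i = U})"
    by (rule card_UN_disjoint) auto
  moreover have "(\<Union>U\<in>birth t ` {..<r s t}. {i. i < r t t \<and> birth t i = U}) = {..<r s t}"
  proof (intro equalityI subsetI)
    fix i assume "i \<in> (\<Union>U\<in>birth t ` {..<r s t}. {i. i < r t t \<and> birth t i = U})"
    then obtain j where "j < r s t" "birth t i = birth t j" by blast
    then show "i \<in> {..<r s t}" using mem_birth[OF assms, of i] mem_birth[OF assms, of j] by simp
  next
    fix i assume "i \<in> {..<r s t}"
    then show "i \<in> (\<Union>U\<in>birth t ` {..<r s t}. {i. i < r t t \<and> birth t i = U})"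
      using mono[OF assms order_refl] by fastforce
  qed
  ultimately show ?thesis unfolding mult_def by simp
qed

lemma mem_births_iff:
  assumes "s \<le> t" "s \<in> U" "0 < mult U t"
  shows "U \<in> birth t ` {..<r s t}"
proof -
  obtain i where "birth t i = U"
    using assms(3) unfolding mult_def by (metis (mono_tags, lifting) card_gt_0_iff empty_Collect_eq)
  then show ?thesis using mem_birth[OF assms(1)] assms(2) by auto
qed

text \<open>A copy of a bar is determined by its left end and its index. The copies that contain
  \<open>s\<close> and \<open>t\<close> correspond to the pairs of a birth \<open>U\<close> at
  \<open>t\<close> with \<open>s\<close> in \<open>U\<close> and an index below
  \<open>mult U t\<close>, and \<open>sum_mult\<close> counts these pairs.\<close>

lemma is_barcode_bars: "is_barcode_of_rank r bars"
  unfolding is_barcode_of_rank_def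
proof (intro conjI allI impI)
  show "real_interval I" if "0 < bars I" for I
    using that unfolding bars_def by (auto split: if_splits)
next
  fix s t :: real assume st: "s \<le> t"
  let ?S = "{I. bars I > 0 \<and> s \<in> I \<and> t \<in> I}"
  let ?X = "SIGMA I:?S. {i. bar (up_closure I) i = I}"
  let ?Y = "SIGMA U:birth t ` {..<r s t}. {..<mult U t}"
  have inS: "I \<in> ?S \<longleftrightarrow> real_interval I \<and> s \<in> I \<and> t \<in> I \<and> (\<exists>i. bar (up_closure I) i = I)" for I
    using finite_bars_index[of I] unfolding bars_def by (auto simp: card_gt_0_iff)
  have bij: "bij_betw (\<lambda>(I, i). (up_closure I, i)) ?X ?Y"
  proof (rule bij_betw_byWitness[where f' = "\<lambda>(U, i). (bar U i, i)"])
    \<comment> \<open>A bound on \<open>i\<close> at time \<open>t\<close> suffices, since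
      \<open>mult_antimono\<close> carries it back to the earlier time \<open>s\<close>.\<close>
    have Y: "s \<in> bar U i \<and> t \<in> bar U i \<and> upset U" if "(U, i) \<in> ?Y" for U i
    proof -
      from that obtain j where j: "U = birth t j" "j < r s t" "i < mult U t" by auto
      then have "s \<in> U" "upset U" using mem_birth[OF st] upset_birth by auto
      moreover from this have "t \<in> U" using st unfolding upset_def by blast
      ultimately show ?thesis using mult_antimono[of U s t] st j(3) unfolding bar_def by auto
    qed
    show "\<forall>a\<in>?X. (\<lambda>(U, i). (bar U i, i)) ((\<lambda>(I, i). (up_closure I, i)) a) = a" by auto
    show "\<forall>a\<in>?Y. (\<lambda>(I, i). (up_closure I, i)) ((\<lambda>(U, i). (bar U i, i)) a) = a"
    proof
      fix z assume "z \<in> ?Y"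
      then obtain U i where z: "z = (U, i)" and Ui: "(U, i) \<in> ?Y" by blast
      then show "(\<lambda>(I, i). (up_closure I, i)) ((\<lambda>(U, i). (bar U i, i)) z) = z"
        using Y[OF Ui] up_closure_bar[of U s i] by simp
    qed
    show "(\<lambda>(I, i). (up_closure I, i)) ` ?X \<subseteq> ?Y"
    proof (rule image_subsetI)
      fix z assume "z \<in> ?X"
      then obtain I i where z: "z = (I, i)" and I: "s \<in> I" "t \<in> I" "bar (up_closure I) i = I"
        by blast
      then have "s \<in> bar (up_closure I) i" "t \<in> bar (up_closure I) i" by simp_all
      then have "s \<in> up_closure I" "i < mult (up_closure I) t"
        unfolding bar_def by simp_all
      then show "(\<lambda>(I, i). (up_closure I, i)) z \<in> ?Y"
        using z mem_births_iff[OF st, of "up_closure I"] by auto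
    qed
    show "(\<lambda>(U, i). (bar U i, i)) ` ?Y \<subseteq> ?X"
    proof (rule image_subsetI)
      fix z assume "z \<in> ?Y"
      then obtain U i where z: "z = (U, i)" and Ui: "(U, i) \<in> ?Y" by blast
      note Y = Y[OF Ui]
      have "up_closure (bar U i) = U" using up_closure_bar[of U s i] Y by blast
      moreover have "bar U i \<in> ?S"
        using inS[of "bar U i"] real_interval_bar[of U s i] Y calculation by auto
      ultimately show "(\<lambda>(U, i). (bar U i, i)) z \<in> ?X" using z by simp
    qed
  qed
  have finY: "finite ?Y" by auto
  then have finX: "finite ?X" using bij bij_betw_finite by blast
  have "?S = fst ` ?X"
  proof (intro equalityI subsetI)
    fix I assume I: "I \<in> ?S"
    then obtain i where "bar (up_closure I) i = I" using inS by blast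
    then have "(I, i) \<in> ?X" using I by simp
    then show "I \<in> fst ` ?X" by force
  qed auto
  then show finS: "finite ?S" using finite_imageI[OF finX, of fst] by (simp only:)
  have "\<forall>I\<in>?S. finite {i. bar (up_closure I) i = I}"
    using inS finite_bars_index by blast
  with finS have "card ?X = (\<Sum>I\<in>?S. card {i. bar (up_closure I) i = I})"
    by (rule card_SigmaI)
  also have "\<dots> = (\<Sum>I\<in>?S. bars I)"
  proof (rule sum.cong)
    fix I assume "I \<in> ?S"
    then have "real_interval I" using inS by blast
    then show "card {i. bar (up_closure I) i = I} = bars I" unfolding bars_def by simp
  qed simp
  finally have "card ?X = (\<Sum>I\<in>?S. bars I)" .
  moreover have "card ?Y = r s t" using sum_mult[OF st] by simp
  ultimately show "r s t = (\<Sum>I\<in>?S. bars I)" using bij_betw_same_card[OF bij] by simp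
qed

end

section \<open>Bottleneck distance from two one-sided matchings\<close>

text \<open>The parameter \<open>a\<close> absorbs the shift in N(d): reflecting N by t |-> d - t
  and Q by t |-> -t puts the bars of N(d) and of Q on the same reversed time axis.\<close>

definition reflect :: "real \<Rightarrow> real set \<Rightarrow> real set" where
  "reflect a I = (\<lambda>x. a - x) ` I"

definition reflect_bar :: "real \<Rightarrow> real set \<times> nat \<Rightarrow> real set \<times> nat" where
  "reflect_bar a e = (reflect a (fst e), snd e)"

lemma mem_reflect [simp]: "x \<in> reflect a I \<longleftrightarrow> a - x \<in> I"
  unfolding reflect_def by (auto intro: image_eqI[of _ _ "a - x"])

lemma reflect_reflect [simp]: "reflect a (reflect a I) = I"
  by (rule set_eqI) simp

lemma reflect_bar_reflect_bar [simp]: "reflect_bar a (reflect_bar a e) = e"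
  unfolding reflect_bar_def by simp

lemma fst_reflect_bar [simp]: "fst (reflect_bar a e) = reflect a (fst e)"
  unfolding reflect_bar_def by simp

lemma real_interval_reflect [simp]: "real_interval (reflect a I) \<longleftrightarrow> real_interval I"
proof -
  have *: "real_interval (reflect a J)" if J: "real_interval J" for J
    unfolding real_interval_def
  proof (intro conjI ballI allI impI)
    obtain x where "x \<in> J" using J unfolding real_interval_def by blast
    then have "a - x \<in> reflect a J" by simp
    then show "reflect a J \<noteq> {}" by blast
    fix x y z assume "x \<in> reflect a J" "z \<in> reflect a J" "x \<le> y \<and> y \<le> z"
    then have "a - x \<in> J" "a - z \<in> J" "a - z \<le> a - y \<and> a - y \<le> a - x" by auto
    then have "a - y \<in> J" using J unfolding real_interval_def by blast
    then show "y \<in> reflect a J" by simp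
  qed
  show ?thesis using *[of I] *[of "reflect a I"] by auto
qed

lemma mem_reflect_barcode [simp]:
  "reflect_bar a e \<in> mset_elems (b \<circ> reflect a) \<longleftrightarrow> e \<in> mset_elems b"
  unfolding reflect_bar_def mset_elems_def by (cases e) simp

lemma is_barcode_reflect:
  assumes "is_barcode_of_rank r b"
  shows "is_barcode_of_rank (\<lambda>s t. r (a - t) (a - s)) (b \<circ> reflect a)"
  unfolding is_barcode_of_rank_def
proof (intro conjI allI impI)
  show "real_interval I" if "0 < (b \<circ> reflect a) I" for I
  proof -
    have "0 < b (reflect a I)" using that by simp
    then have "real_interval (reflect a I)"
      using assms unfolding is_barcode_of_rank_def by blast
    then show ?thesis by simp
  qed
  fix s t :: real assume "s \<le> t"
  then have st: "a - t \<le> a - s" by simp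
  let ?S = "{I. 0 < (b \<circ> reflect a) I \<and> s \<in> I \<and> t \<in> I}"
  let ?T = "{I. 0 < b I \<and> a - t \<in> I \<and> a - s \<in> I}"
  have T: "finite ?T" "r (a - t) (a - s) = (\<Sum>I\<in>?T. b I)"
    using assms st unfolding is_barcode_of_rank_def by blast+
  have eq: "?S = reflect a ` ?T"
  proof (intro equalityI subsetI)
    fix I assume "I \<in> ?S"
    then have "reflect a I \<in> ?T" by simp
    then have "reflect a (reflect a I) \<in> reflect a ` ?T" by (rule imageI)
    then show "I \<in> reflect a ` ?T" by simp
  qed auto
  show "finite ?S" unfolding eq using T(1) by (rule finite_imageI)
  have "inj_on (reflect a) ?T" by (rule inj_on_inverseI[where g = "reflect a"]) simp
  then have "(\<Sum>I\<in>?S. (b \<circ> reflect a) I) = (\<Sum>I\<in>?T. b I)"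
    unfolding eq by (simp add: sum.reindex)
  then show "r (a - t) (a - s) = (\<Sum>I\<in>?S. (b \<circ> reflect a) I)" using T(2) by simp
qed

section \<open>End points and lengths in the extended reals\<close>

lemma lend_le:
  assumes "\<forall>y\<in>K. \<exists>x\<in>I. x \<le> y + d"
  shows "lend I \<le> lend K + ereal d"
proof -
  have "lend I - ereal d \<le> lend K"
    unfolding lend_def[of K]
  proof (rule INF_greatest)
    fix y assume "y \<in> K"
    then obtain x where x: "x \<in> I" "x \<le> y + d" using assms by blast
    have "lend I \<le> ereal x" unfolding lend_def using x(1) by (rule INF_lower)
    also have "\<dots> \<le> ereal y + ereal d" using x(2) by simp
    finally show "lend I - ereal d \<le> ereal y" by (simp add: ereal_minus_le)
  qed
  then show ?thesis by (simp add: ereal_minus_le)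
qed

lemma rend_le:
  assumes "\<forall>x\<in>I. \<exists>y\<in>K. x \<le> y + d"
  shows "rend I \<le> rend K + ereal d"
  unfolding rend_def[of I]
proof (rule SUP_least)
  fix x assume "x \<in> I"
  then obtain y where y: "y \<in> K" "x \<le> y + d" using assms by blast
  have "ereal y \<le> rend K" unfolding rend_def using y(1) by (rule SUP_upper)
  then have "ereal y + ereal d \<le> rend K + ereal d" by (rule add_right_mono)
  moreover have "ereal x \<le> ereal y + ereal d" using y(2) by simp
  ultimately show "ereal x \<le> rend K + ereal d" by (rule order_trans[rotated])
qed

text \<open>The two inequalities force both ends to be finite or to be the same infinity, and in the
  latter case \<open>edist\<close> is 0 by definition.\<close>

lemma edist_le:
  assumes "a \<le> b + ereal d" "b \<le> a + ereal d" "0 \<le> d"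
  shows "edist a b \<le> ereal d"
  using assms by (cases a; cases b) (auto simp: edist_def)

lemma half_length_le:
  assumes I: "real_interval I" and short: "\<And>t. t \<in> I \<Longrightarrow> t + 2 * d \<notin> I" and "0 \<le> d"
  shows "(rend I - lend I) / 2 \<le> ereal d"
proof -
  have bound: "y \<le> x + 2 * d" if "x \<in> I" "y \<in> I" for x y
  proof (rule ccontr)
    assume "\<not> y \<le> x + 2 * d"
    \<comment> \<open>This point would lie between the points \<open>x\<close> and \<open>y\<close>
      of the interval.\<close>
    then have "x + 2 * d \<in> I"
      using I that \<open>0 \<le> d\<close> unfolding real_interval_def by (meson add_increasing2 linear mult_nonneg_nonneg zero_le_numeral order_refl)
    then show False using short that by blast
  qed
  obtain x0 where x0: "x0 \<in> I" using I unfolding real_interval_def by blast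
  have *: "rend I \<le> ereal x + ereal (2 * d)" if "x \<in> I" for x
    unfolding rend_def by (rule SUP_least) (use bound that in simp)
  have "rend I - ereal (2 * d) \<le> lend I"
    unfolding lend_def by (rule INF_greatest) (use * in \<open>simp add: ereal_minus_le\<close>)
  moreover have "ereal x0 \<le> rend I" unfolding rend_def using x0 by (rule SUP_upper)
  moreover have "lend I \<le> ereal x0" unfolding lend_def using x0 by (rule INF_lower)
  ultimately show ?thesis
    using *[OF x0] by (cases "rend I"; cases "lend I") auto
qed

text \<open>The matching \<open>X\<close> composes \<open>L\<close> with the converse of
  \<open>R\<close>. Every bar of Q is matched on both sides, so the composition loses no partner.
  Only bars without two points at distance \<open>2 * d\<close> can stay unmatched, and half their
  length is at most \<open>d\<close>.\<close>

theorem bottleneck_le: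
  fixes rM rN rQ :: "real \<Rightarrow> real \<Rightarrow> nat"
  assumes M: "is_barcode_of_rank rM bM" and N: "is_barcode_of_rank rN bN"
    and Q: "is_barcode_of_rank rQ bQ" and d: "0 \<le> d"
    and left: "left_domination rM rQ bM bQ (2 * d)"
    and right: "left_domination (\<lambda>s t. rN (d - t) (d - s)) (\<lambda>s t. rQ (0 - t) (0 - s))
      (bN \<circ> reflect d) (bQ \<circ> reflect 0) (2 * d)"
  shows "bottleneck_dist bM bN \<le> ereal d"
proof -
  define L where "L = left_matching bM bQ"
  define R where "R = left_matching (bN \<circ> reflect d) (bQ \<circ> reflect 0)"
  define X where "X = {(x, z). \<exists>y. (x, y) \<in> L \<and> (reflect_bar d z, reflect_bar 0 y) \<in> R}"
  have L: "partial_matching bM bQ L"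
    unfolding L_def by (rule left_matching_partial[OF M Q])
  have R: "partial_matching (bN \<circ> reflect d) (bQ \<circ> reflect 0) R"
    unfolding R_def by (rule left_matching_partial[OF is_barcode_reflect[OF N] is_barcode_reflect[OF Q]])
  have inj: "x = x'" if "reflect_bar a x = reflect_bar a x'" for a x x'
    using that by (metis reflect_bar_reflect_bar)
  have X: "partial_matching bM bN X"
    unfolding partial_matching_def
  proof (intro conjI allI impI)
    show "X \<subseteq> mset_elems bM \<times> mset_elems bN"
    proof
      fix e assume "e \<in> X"
      then obtain x y z where e: "e = (x, z)" "(x, y) \<in> L" "(reflect_bar d z, reflect_bar 0 y) \<in> R"
        unfolding X_def by blast
      then have "x \<in> mset_elems bM" "reflect_bar d z \<in> mset_elems (bN \<circ> reflect d)"
        using L R unfolding partial_matching_def by blast+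
      then show "e \<in> mset_elems bM \<times> mset_elems bN" using e(1) by simp
    qed
    show "z = z'" if "(x, z) \<in> X" "(x, z') \<in> X" for x z z'
    proof -
      obtain y y' where y: "(x, y) \<in> L" "(reflect_bar d z, reflect_bar 0 y) \<in> R"
        "(x, y') \<in> L" "(reflect_bar d z', reflect_bar 0 y') \<in> R"
        using \<open>(x, z) \<in> X\<close> \<open>(x, z') \<in> X\<close> unfolding X_def by blast
      then have "y = y'" using L unfolding partial_matching_def by blast
      then have "reflect_bar d z = reflect_bar d z'"
        using y(2,4) R unfolding partial_matching_def by blast
      then show ?thesis by (rule inj)
    qed
    show "x = x'" if "(x, z) \<in> X" "(x', z) \<in> X" for x x' z
    proof -
      obtain y y' where y: "(x, y) \<in> L" "(reflect_bar d z, reflect_bar 0 y) \<in> R"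
        "(x', y') \<in> L" "(reflect_bar d z, reflect_bar 0 y') \<in> R"
        using \<open>(x, z) \<in> X\<close> \<open>(x', z) \<in> X\<close> unfolding X_def by blast
      then have "reflect_bar 0 y = reflect_bar 0 y'" using R unfolding partial_matching_def by blast
      then have "y = y'" by (rule inj)
      then show ?thesis using y(1,3) L unfolding partial_matching_def by blast
    qed
  qed
  have matched: "max (edist (lend (fst x)) (lend (fst z))) (edist (rend (fst x)) (rend (fst z))) \<le> ereal d"
    if xz: "(x, z) \<in> X" for x z
  proof -
    obtain y where y: "(x, y) \<in> L" "(reflect_bar d z, reflect_bar 0 y) \<in> R"
      using xz unfolding X_def by blast
    define I J K where "I = fst x" and "J = fst y" and "K = fst z"
    have "y \<in> mset_elems bQ" using y(1) L unfolding partial_matching_def by blast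
    then have "real_interval J" unfolding J_def by (rule mset_elems_interval[OF Q])
    then obtain j where j: "j \<in> J" unfolding real_interval_def by blast
    have upIJ: "up_closure I = up_closure J"
      using y(1) unfolding L_def left_matching_def I_def J_def by simp
    have JI: "J \<subseteq> I"
      using left_domination.matched_subset[OF left y(1)[unfolded L_def]] unfolding I_def J_def .
    have IJ: "t \<in> J" if "t \<in> up_closure I" "t + 2 * d \<in> I" for t
      using left_domination.matched_subset'[OF left y(1)[unfolded L_def]] that unfolding I_def J_def .
    have upKJ: "up_closure (reflect d K) = up_closure (reflect 0 J)"
      using y(2) unfolding R_def left_matching_def K_def J_def by simp
    \<comment> \<open>Reflected back, the second matching places \<open>J\<close> shifted by
      \<open>d\<close> inside \<open>K\<close>; by \<open>KJ\<close> the shifted copy begins at most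
      \<open>2 * d\<close> after \<open>K\<close> does.\<close>
    have JK: "u + d \<in> K" if "u \<in> J" for u
    proof -
      have "- u \<in> reflect 0 J" using that by simp
      then have "- u \<in> reflect d K"
        using left_domination.matched_subset[OF right y(2)[unfolded R_def]]
        unfolding K_def J_def fst_reflect_bar by blast
      then show ?thesis by (simp add: add.commute)
    qed
    have KJ: "u \<in> J" if "u - d \<in> K" "u \<le> j'" "j' \<in> J" for u j'
    proof -
      have "- u \<in> up_closure (reflect 0 J)"
        using that(2,3) unfolding up_closure_def by (auto intro!: bexI[of _ "- j'"])
      then have "- u \<in> reflect 0 J"
        using left_domination.matched_subset'[OF right y(2)[unfolded R_def], of "- u"] that(1) upKJ
        unfolding K_def J_def by simp
      then show ?thesis by simp
    qed
    have "\<exists>v\<in>K. v \<le> u + d" if "u \<in> I" for u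
    proof -
      have "u \<in> up_closure J" using that upIJ subset_up_closure by blast
      then obtain j' where "j' \<in> J" "j' \<le> u" unfolding up_closure_def by blast
      then show ?thesis using JK[of j'] by (intro bexI[of _ "j' + d"]) auto
    qed
    then have 1: "lend K \<le> lend I + ereal d" by (intro lend_le) blast
    have "\<exists>u\<in>I. u \<le> v + d" if v: "v \<in> K" for v
    \<comment> \<open>If \<open>v + d\<close> lies beyond \<open>j\<close>, then \<open>j\<close>
      itself is the required point of \<open>I\<close>.\<close>
    proof (cases "v + d \<le> j")
      case True
      then have "v + d \<in> J" using KJ[of "v + d" j] v j by simp
      then show ?thesis using JI by blast
    next
      case False
      then show ?thesis using j JI by (intro bexI[of _ j]) auto
    qed
    then have 2: "lend I \<le> lend K + ereal d" by (intro lend_le) blast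
    have "\<exists>u\<in>I. v \<le> u + d" if v: "v \<in> K" for v
    proof -
      have "d - v \<in> up_closure (reflect 0 J)"
        using v upKJ subset_up_closure[of "reflect d K"] by auto
      then obtain j' where "- j' \<in> J" "j' \<le> d - v" unfolding up_closure_def by auto
      then show ?thesis using JI by (intro bexI[of _ "- j'"]) auto
    qed
    then have 3: "rend K \<le> rend I + ereal d" by (intro rend_le) blast
    have "\<exists>v\<in>K. u \<le> v + d" if u: "u \<in> I" for u
    \<comment> \<open>If \<open>u - 2 * d\<close> lies before the left end of \<open>I\<close>, then
      \<open>j\<close> lies to the right of it and \<open>j + d\<close> is the required point of
      \<open>K\<close>.\<close>
    proof (cases "u - 2 * d \<in> up_closure I")
      case True
      then have "u - 2 * d \<in> J" using IJ[of "u - 2 * d"] u by simp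
      then show ?thesis using JK[of "u - 2 * d"] by (intro bexI[of _ "u - 2 * d + d"]) auto
    next
      case False
      then have "\<not> j \<le> u - 2 * d" using j JI unfolding up_closure_def by blast
      then show ?thesis using JK[OF j] by (intro bexI[of _ "j + d"]) auto
    qed
    then have 4: "rend I \<le> rend K + ereal d" by (intro rend_le) blast
    show ?thesis
      using edist_le[OF 2 1 d] edist_le[OF 4 3 d] unfolding I_def K_def by simp
  qed
  have unmatched1: "(rend (fst x) - lend (fst x)) / 2 \<le> ereal d"
    if x: "x \<in> mset_elems bM" "x \<notin> Domain X" for x
  proof (rule half_length_le[OF mset_elems_interval[OF M x(1)] _ d])
    fix t assume t: "t \<in> fst x"
    show "t + 2 * d \<notin> fst x"
    proof
      assume "t + 2 * d \<in> fst x"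
      then obtain y where y: "(x, y) \<in> L"
        using left_domination.long_bars_matched[OF left x(1) t] unfolding L_def by blast
      then have "reflect_bar 0 y \<in> mset_elems (bQ \<circ> reflect 0)"
        using L unfolding partial_matching_def by auto
      then obtain w where w: "(w, reflect_bar 0 y) \<in> R"
        using left_domination.all_targets_matched[OF right] unfolding R_def by blast
      then have "(reflect_bar d (reflect_bar d w), reflect_bar 0 y) \<in> R" by simp
      then have "(x, reflect_bar d w) \<in> X" using y unfolding X_def by blast
      then show False using x(2) by blast
    qed
  qed
  have unmatched2: "(rend (fst z) - lend (fst z)) / 2 \<le> ereal d"
    if z: "z \<in> mset_elems bN" "z \<notin> Range X" for z
  proof (rule half_length_le[OF mset_elems_interval[OF N z(1)] _ d])
    fix t assume t: "t \<in> fst z"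
    have z': "reflect_bar d z \<in> mset_elems (bN \<circ> reflect d)" using z(1) by simp
    show "t + 2 * d \<notin> fst z"
    proof
      assume t': "t + 2 * d \<in> fst z"
      \<comment> \<open>Reflection reverses the order, so the image of \<open>t + 2 * d\<close> is
        the earlier of the two points that \<open>long_bars_matched\<close> asks for.\<close>
      have "d - (t + 2 * d) \<in> fst (reflect_bar d z)" using t' by (simp add: add.commute)
      moreover have "d - (t + 2 * d) + 2 * d \<in> fst (reflect_bar d z)" using t by simp
      ultimately obtain w where w: "(reflect_bar d z, w) \<in> R"
        using left_domination.long_bars_matched[OF right z'] unfolding R_def by blast
      define y where "y = reflect_bar 0 w"
      have y: "reflect_bar 0 y = w" unfolding y_def by simp
      then have "y \<in> mset_elems bQ"
        using w R mem_reflect_barcode[of 0 y bQ] unfolding partial_matching_def by auto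
      then obtain x where "(x, y) \<in> L"
        using left_domination.all_targets_matched[OF left] unfolding L_def by blast
      moreover have "(reflect_bar d z, reflect_bar 0 y) \<in> R" using w y by simp
      ultimately have "(x, z) \<in> X" unfolding X_def by blast
      then show False using z(2) by blast
    qed
  qed
  have "bottleneck_dist bM bN \<le> matching_cost bM bN X"
    unfolding bottleneck_dist_def using X by (intro Inf_lower) blast
  also have "\<dots> \<le> ereal d"
    unfolding matching_cost_def
    using matched unmatched1 unmatched2 d by (intro Sup_least) (elim UnE; auto)
  finally show ?thesis .
qed

section \<open>Algebraic stability\<close>

lemma subspace_fin_dim: "fin_dim_subspace s A \<Longrightarrow> module.subspace s A"
  unfolding fin_dim_subspace_def by blast

lemma pers_fin_dim:
  assumes "pers_space s P \<phi>" "pfd s P"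
  shows "fin_dim_subspace s (P t)"
proof -
  have "\<forall>u. module.subspace s (P u)" using assms(1) unfolding pers_space_def by (elim conjE)
  moreover obtain B where "finite B" "P t \<subseteq> module.span s B"
    using assms(2) unfolding pfd_def by blast
  ultimately show ?thesis unfolding fin_dim_subspace_def by blast
qed

lemma pers_lin:
  assumes "pers_space s P \<phi>" "t \<le> u"
  shows "lin_on s s (P t) (\<phi> t u)" "\<phi> t u ` P t \<subseteq> P u"
proof -
  have "\<forall>u v. u \<le> v \<longrightarrow> lin_on s s (P u) (\<phi> u v) \<and> \<phi> u v ` P u \<subseteq> P v"
    using assms(1) unfolding pers_space_def by (elim conjE)
  from this[rule_format, OF assms(2)]
  show "lin_on s s (P t) (\<phi> t u)" "\<phi> t u ` P t \<subseteq> P u" by simp_all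
qed

lemma pers_comp:
  assumes "pers_space s P \<phi>" "t \<le> u" "u \<le> v" "x \<in> P t"
  shows "\<phi> u v (\<phi> t u x) = \<phi> t v x"
proof -
  have "\<forall>u v w. u \<le> v \<longrightarrow> v \<le> w \<longrightarrow> (\<forall>x\<in>P u. \<phi> v w (\<phi> u v x) = \<phi> u w x)"
    using assms(1) unfolding pers_space_def by (elim conjE)
  from this[rule_format, OF assms(2-4)] show ?thesis .
qed

lemma pers_comp_image:
  assumes "pers_space s P \<phi>" "t \<le> u" "u \<le> v" "A \<subseteq> P t"
  shows "\<phi> u v ` \<phi> t u ` A = \<phi> t v ` A"
  unfolding image_image
  by (rule image_cong[OF refl pers_comp[OF assms(1-3) subsetD[OF assms(4)]]])

lemma pers_image_mono:
  assumes P: "pers_space s P \<phi>" and "t \<le> u" "u \<le> v"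
  shows "\<phi> t v ` P t \<subseteq> \<phi> u v ` P u"
  using image_mono[OF pers_lin(2)[OF P \<open>t \<le> u\<close>], of "\<phi> u v"]
  unfolding pers_comp_image[OF assms order_refl] .

lemma pers_fin_dim_image:
  assumes "vector_space s" "pers_space s P \<phi>" "pfd s P" "t \<le> u"
  shows "fin_dim_subspace s (\<phi> t u ` P t)"
  using fin_dim_subspace_image[OF assms(1,1) pers_fin_dim[OF assms(2,3)] pers_lin(1)[OF assms(2,4)]] .

text \<open>Supermodularity is \<open>dim_image_diff_le\<close> for the transition map from
  \<open>t\<close> to \<open>t'\<close>, applied to the image of \<open>P u\<close> in
  \<open>P t\<close> and to the smaller image of \<open>P u'\<close>.\<close>

lemma rank_function_rank_inv:
  fixes P :: "real \<Rightarrow> 'v::ab_group_add set"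
  assumes V: "vector_space s" and P: "pers_space s P \<phi>" and fd: "pfd s P"
  shows "rank_function (rank_inv s P \<phi>)"
proof
  note fin = pers_fin_dim_image[OF V P fd]
  note sub = pers_image_mono[OF P]
  show "rank_inv s P \<phi> u' t \<le> rank_inv s P \<phi> u t" if "u' \<le> u" "u \<le> t" for u' u t
    unfolding rank_inv_def by (rule dim_mono[OF V fin[OF that(2)] sub[OF that]])
  have im: "rank_inv s P \<phi> u t' = vector_space.dim s (\<phi> t t' ` \<phi> u t ` P u)"
    if "u \<le> t" "t \<le> t'" for u t t'
    unfolding rank_inv_def by (rule arg_cong[OF pers_comp_image[OF P that order_refl, symmetric]])
  have lin: "lin_on s s (\<phi> u t ` P u) (\<phi> t t')" if "u \<le> t" "t \<le> t'" for u t t'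
    by (rule lin_on_subset[OF pers_lin(1)[OF P that(2)] pers_lin(2)[OF P that(1)]])
  show "rank_inv s P \<phi> u t' \<le> rank_inv s P \<phi> u t" if "u \<le> t" "t \<le> t'" for u t t'
    unfolding im[OF that] unfolding rank_inv_def by (rule dim_image_le[OF V V fin[OF that(1)] lin[OF that]])
  show "rank_inv s P \<phi> u t' + rank_inv s P \<phi> u' t \<le> rank_inv s P \<phi> u t + rank_inv s P \<phi> u' t'"
    if u: "u' \<le> u" "u \<le> t" "t \<le> t'" for u' u t t'
  proof -
    have u't: "u' \<le> t" using u by simp
    show ?thesis
      unfolding im[OF u(2,3)] im[OF u't u(3)] unfolding rank_inv_def
      by (rule dim_image_diff_le[OF V V fin[OF u(2)] subspace_fin_dim[OF fin[OF u't]]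
          sub[OF u(1,2)] lin[OF u(2,3)]])
  qed
qed

lemma is_barcode_of_rank_barcode:
  assumes "rank_function (rank_inv s P \<phi>)"
  shows "is_barcode_of_rank (rank_inv s P \<phi>) (barcode s P \<phi>)"
  unfolding barcode_def
proof (rule theI'[where P = "is_barcode_of_rank (rank_inv s P \<phi>)"], rule ex_ex1I)
  show "\<exists>b. is_barcode_of_rank (rank_inv s P \<phi>) b"
    by (rule exI, rule rank_function.is_barcode_bars[OF assms])
  show "b = c" if "is_barcode_of_rank (rank_inv s P \<phi>) b" "is_barcode_of_rank (rank_inv s P \<phi>) c" for b c
    by (rule barcode_unique[OF that])
qed

section \<open>The image of an interleaving morphism\<close>

locale interleaving_1d =
  fixes sM :: "'f::field \<Rightarrow> 'v::ab_group_add \<Rightarrow> 'v"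
    and sN :: "'f \<Rightarrow> 'w::ab_group_add \<Rightarrow> 'w"
    and M :: "real \<Rightarrow> 'v set" and \<phi> :: "real \<Rightarrow> real \<Rightarrow> 'v \<Rightarrow> 'v"
    and N :: "real \<Rightarrow> 'w set" and \<psi> :: "real \<Rightarrow> real \<Rightarrow> 'w \<Rightarrow> 'w"
    and \<delta> :: real and f :: "real \<Rightarrow> 'v \<Rightarrow> 'w" and g :: "real \<Rightarrow> 'w \<Rightarrow> 'v"
  assumes VM: "vector_space sM" and VN: "vector_space sN"
    and M: "pers_space sM M \<phi>" and N: "pers_space sN N \<psi>"
    and pfdM: "pfd sM M" and pfdN: "pfd sN N"
    and \<delta>: "0 \<le> \<delta>"
    and f: "lin_on sM sN (M t) (f t)" "f t ` M t \<subseteq> N (t + \<delta>)"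
    and g: "lin_on sN sM (N t) (g t)" "g t ` N t \<subseteq> M (t + \<delta>)"
    and f_nat: "s \<le> t \<Longrightarrow> x \<in> M s \<Longrightarrow> f t (\<phi> s t x) = \<psi> (s + \<delta>) (t + \<delta>) (f s x)"
    and gf: "x \<in> M t \<Longrightarrow> g (t + \<delta>) (f t x) = \<phi> t (t + 2 * \<delta>) x"
    and fg: "y \<in> N t \<Longrightarrow> f (t + \<delta>) (g t y) = \<psi> t (t + 2 * \<delta>) y"
begin

text \<open>The image Q of \<open>f\<close> has the spaces f(M t) inside N(t + \<delta>) and the
  transition maps of N. By naturality, \<open>f t\<close> followed by nothing else than
  \<open>\<phi> s t\<close> on \<open>M s\<close> already gives the image of Q at \<open>s\<close>
  in Q at \<open>t\<close>, so Q enters through its ranks only.\<close>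

definition rank_image :: "real \<Rightarrow> real \<Rightarrow> nat" where
  "rank_image s t = vector_space.dim sN (f t ` \<phi> s t ` M s)"

abbreviation "rank_M \<equiv> rank_inv sM M \<phi>"
abbreviation "rank_N \<equiv> rank_inv sN N \<psi>"

abbreviation im :: "real \<Rightarrow> real \<Rightarrow> 'w set" where
  "im s t \<equiv> f t ` \<phi> s t ` M s"

lemmas fin_M = pers_fin_dim_image[OF VM M pfdM]
lemmas fin_N = pers_fin_dim_image[OF VN N pfdN]
lemmas sub_M = pers_image_mono[OF M]

lemma lin_f: "s \<le> t \<Longrightarrow> lin_on sM sN (\<phi> s t ` M s) (f t)"
  by (rule lin_on_subset[OF f(1) pers_lin(2)[OF M]])

lemma fin_im: "s \<le> t \<Longrightarrow> fin_dim_subspace sN (im s t)"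
  using fin_dim_subspace_image[OF VM VN fin_M lin_f] .

lemma im_subset: "s \<le> t \<Longrightarrow> im s t \<subseteq> N (t + \<delta>)"
  by (rule order_trans[OF image_mono[OF pers_lin(2)[OF M]] f(2)])

lemma sub_im: "s' \<le> s \<Longrightarrow> s \<le> t \<Longrightarrow> im s' t \<subseteq> im s t"
  by (intro image_mono sub_M)

lemma im_eq: "s \<le> t \<Longrightarrow> im s t = \<psi> (s + \<delta>) (t + \<delta>) ` f s ` M s"
  unfolding image_image by (rule image_cong[OF refl f_nat])

lemma push_im:
  assumes "s \<le> t" "t \<le> t'"
  shows "\<psi> (t + \<delta>) (t' + \<delta>) ` im s t = im s t'"
proof -
  have "s \<le> t'" "s + \<delta> \<le> t + \<delta>" "t + \<delta> \<le> t' + \<delta>" using assms by simp_all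
  then show ?thesis
    unfolding im_eq[OF \<open>s \<le> t\<close>] im_eq[OF \<open>s \<le> t'\<close>] by (intro pers_comp_image[OF N _ _ f(2)])
qed

text \<open>Applying \<open>g\<close> to the image recovers a transition map of M that is longer by
  \<open>2 * \<delta>\<close>. This supplies the inequalities \<open>le'\<close> and
  \<open>diff'\<close> of \<open>left_domination\<close>.\<close>

lemma pull_im: "s \<le> t \<Longrightarrow> g (t + \<delta>) ` im s t = \<phi> s (t + 2 * \<delta>) ` M s"
proof -
  assume st: "s \<le> t"
  have "g (t + \<delta>) ` f t ` A = \<phi> t (t + 2 * \<delta>) ` A" if "A \<subseteq> M t" for A
    unfolding image_image by (rule image_cong[OF refl gf[OF subsetD[OF that]]])
  then have "g (t + \<delta>) ` im s t = \<phi> t (t + 2 * \<delta>) ` \<phi> s t ` M s"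
    using pers_lin(2)[OF M st] .
  also have "\<dots> = \<phi> s (t + 2 * \<delta>) ` M s"
    by (rule pers_comp_image[OF M st _ order_refl]) (use \<delta> in simp)
  finally show ?thesis .
qed

lemma im_subset_N: "s \<le> t \<Longrightarrow> im s t \<subseteq> \<psi> (s + \<delta>) (t + \<delta>) ` N (s + \<delta>)"
  by (subst im_eq, assumption, rule image_mono[OF f(2)])

text \<open>The transition map of N from \<open>s - \<delta>\<close> to \<open>s + \<delta>\<close>
  is \<open>f s\<close> after \<open>g (s - \<delta>)\<close>, so its image lies in f(M s). With
  \<open>im_subset_N\<close> this encloses \<open>im s t\<close> between two images of transition
  maps of N.\<close>

lemma N_subset_im:
  assumes "s \<le> t"
  shows "\<psi> (s - \<delta>) (t + \<delta>) ` N (s - \<delta>) \<subseteq> im s t"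
proof -
  have comp: "\<psi> (s - \<delta>) (t + \<delta>) ` N (s - \<delta>) = \<psi> (s + \<delta>) (t + \<delta>) ` \<psi> (s - \<delta>) (s + \<delta>) ` N (s - \<delta>)"
    by (rule pers_comp_image[OF N _ _ order_refl, symmetric]) (use assms \<delta> in simp_all)
  have "\<psi> (s - \<delta>) (s + \<delta>) ` N (s - \<delta>) = f s ` g (s - \<delta>) ` N (s - \<delta>)"
  proof -
    have "\<psi> (s - \<delta>) (s + \<delta>) y = f s (g (s - \<delta>) y)" if "y \<in> N (s - \<delta>)" for y
    proof -
      have eq: "s - \<delta> + \<delta> = s" "s - \<delta> + 2 * \<delta> = s + \<delta>" by simp_all
      show ?thesis using fg[OF that] unfolding eq by simp
    qed
    then show ?thesis unfolding image_image by (rule image_cong[OF refl])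
  qed
  also have "\<dots> \<subseteq> f s ` M s" by (rule image_mono) (use g(2)[of "s - \<delta>"] in simp)
  finally have "\<psi> (s - \<delta>) (s + \<delta>) ` N (s - \<delta>) \<subseteq> f s ` M s" .
  then show ?thesis unfolding im_eq[OF assms] comp by (rule image_mono)
qed

lemma lin_\<psi>: "s \<le> t \<Longrightarrow> A \<subseteq> N s \<Longrightarrow> lin_on sN sN A (\<psi> s t)"
  by (rule lin_on_subset[OF pers_lin(1)[OF N]])

lemma lin_g_im: "s \<le> t \<Longrightarrow> lin_on sN sM (im s t) (g (t + \<delta>))"
  by (rule lin_on_subset[OF g(1) im_subset])

lemma rank_function_image: "rank_function rank_image"
proof
  show "rank_image s' t \<le> rank_image s t" if "s' \<le> s" "s \<le> t" for s' s t
    unfolding rank_image_def by (rule dim_mono[OF VN fin_im[OF that(2)] sub_im[OF that]])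
  show "rank_image s t' \<le> rank_image s t" if st: "s \<le> t" "t \<le> t'" for s t t'
    unfolding rank_image_def push_im[OF st, symmetric]
    by (rule dim_image_le[OF VN VN fin_im[OF st(1)] lin_\<psi>[OF _ im_subset[OF st(1)]]]) (use st(2) in simp)
  show "rank_image s t' + rank_image s' t \<le> rank_image s t + rank_image s' t'"
    if st: "s' \<le> s" "s \<le> t" "t \<le> t'" for s' s t t'
  proof -
    have s't: "s' \<le> t" using st by simp
    have tt': "t + \<delta> \<le> t' + \<delta>" using st by simp
    show ?thesis
      unfolding rank_image_def push_im[OF st(2,3), symmetric] push_im[OF s't st(3), symmetric]
      by (rule dim_image_diff_le[OF VN VN fin_im[OF st(2)] subspace_fin_dim[OF fin_im[OF s't]]
          sub_im[OF st(1,2)] lin_\<psi>[OF tt' im_subset[OF st(2)]]])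
  qed
qed

text \<open>The unprimed inequalities compare dimensions under \<open>f\<close> on images of
  transition maps of M, the primed ones under \<open>g\<close> on the spaces
  \<open>im s t\<close>.\<close>

lemma left_domination_image:
  assumes "is_barcode_of_rank rank_M b" "is_barcode_of_rank rank_image c"
  shows "left_domination rank_M rank_image b c (2 * \<delta>)"
proof
  show "rank_image s t \<le> rank_M s t" if "s \<le> t" for s t
    unfolding rank_image_def rank_inv_def by (rule dim_image_le[OF VM VN fin_M[OF that] lin_f[OF that]])
  show "rank_M s (t + 2 * \<delta>) \<le> rank_image s t" if "s \<le> t" for s t
    unfolding rank_image_def rank_inv_def pull_im[OF that, symmetric]
    by (rule dim_image_le[OF VN VM fin_im[OF that] lin_g_im[OF that]])
  fix s' s t :: real assume st: "s' \<le> s" "s \<le> t"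
  then have s't: "s' \<le> t" by simp
  show "rank_image s t + rank_M s' t \<le> rank_M s t + rank_image s' t"
    unfolding rank_image_def rank_inv_def
    by (rule dim_image_diff_le[OF VM VN fin_M[OF st(2)] subspace_fin_dim[OF fin_M[OF s't]]
        sub_M[OF st] lin_f[OF st(2)]])
  show "rank_M s (t + 2 * \<delta>) + rank_image s' t \<le> rank_image s t + rank_M s' (t + 2 * \<delta>)"
    unfolding rank_image_def rank_inv_def pull_im[OF st(2), symmetric] pull_im[OF s't, symmetric]
    by (rule dim_image_diff_le[OF VN VM fin_im[OF st(2)] subspace_fin_dim[OF fin_im[OF s't]]
        sub_im[OF st] lin_g_im[OF st(2)]])
qed (use assms \<delta> in simp_all)

lemma right_image_le:
  assumes "s \<le> t"
  shows "rank_image s t \<le> rank_N (s + \<delta>) (t + \<delta>)"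
proof -
  have "s + \<delta> \<le> t + \<delta>" using assms by simp
  then show ?thesis
    unfolding rank_image_def rank_inv_def by (rule dim_mono[OF VN fin_N im_subset_N[OF assms]])
qed

lemma right_image_le':
  assumes "s \<le> t"
  shows "rank_N (s - \<delta>) (t + \<delta>) \<le> rank_image s t"
  unfolding rank_image_def rank_inv_def by (rule dim_mono[OF VN fin_im[OF assms] N_subset_im[OF assms]])

lemma push_N:
  assumes "s \<le> t" "t \<le> t'"
  shows "rank_N s t' = vector_space.dim sN (\<psi> t t' ` \<psi> s t ` N s)"
  unfolding rank_inv_def pers_comp_image[OF N assms order_refl] by (rule refl)

text \<open>The map is the transition from \<open>t + \<delta>\<close> to
  \<open>t' + \<delta>\<close>, the larger space is the image of \<open>N (s + \<delta>)\<close> in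
  \<open>N (t + \<delta>)\<close>, and the subspace is \<open>im s t\<close>. In
  \<open>right_image_diff'\<close> it is \<open>im s t\<close> that is the larger space, with the
  image of \<open>N (s - \<delta>)\<close> inside it.\<close>

lemma right_image_diff:
  assumes st: "s \<le> t" "t \<le> t'"
  shows "rank_image s t + rank_N (s + \<delta>) (t' + \<delta>) \<le> rank_N (s + \<delta>) (t + \<delta>) + rank_image s t'"
proof -
  have st\<delta>: "s + \<delta> \<le> t + \<delta>" "t + \<delta> \<le> t' + \<delta>" using st by auto
  have "rank_N (s + \<delta>) (t' + \<delta>) + rank_image s t \<le> rank_N (s + \<delta>) (t + \<delta>) + rank_image s t'"
    unfolding push_N[OF st\<delta>] unfolding rank_image_def rank_inv_def push_im[OF st, symmetric]
    by (rule dim_image_diff_le[OF VN VN fin_N[OF st\<delta>(1)] subspace_fin_dim[OF fin_im[OF st(1)]]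
        im_subset_N[OF st(1)] lin_\<psi>[OF st\<delta>(2) pers_lin(2)[OF N st\<delta>(1)]]])
  then show ?thesis by simp
qed

lemma right_image_diff':
  assumes st: "s \<le> t" "t \<le> t'"
  shows "rank_N (s - \<delta>) (t + \<delta>) + rank_image s t' \<le> rank_image s t + rank_N (s - \<delta>) (t' + \<delta>)"
proof -
  have st\<delta>: "s - \<delta> \<le> t + \<delta>" "t + \<delta> \<le> t' + \<delta>" using st \<delta> by auto
  have "rank_image s t' + rank_N (s - \<delta>) (t + \<delta>) \<le> rank_image s t + rank_N (s - \<delta>) (t' + \<delta>)"
    unfolding push_N[OF st\<delta>] unfolding rank_image_def rank_inv_def push_im[OF st, symmetric]
    by (rule dim_image_diff_le[OF VN VN fin_im[OF st(1)] subspace_fin_dim[OF fin_N[OF st\<delta>(1)]]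
        N_subset_im[OF st(1)] lin_\<psi>[OF st\<delta>(2) im_subset[OF st(1)]]])
  then show ?thesis by simp
qed

text \<open>Time reversal turns the inclusion of Q into N(\<delta>) into the situation of
  \<open>left_domination\<close>: the four inequalities become the lemmas on
  \<open>right_image\<close> at the negated times.\<close>

lemma right_domination_image:
  assumes "is_barcode_of_rank rank_N b" "is_barcode_of_rank rank_image c"
  shows "left_domination (\<lambda>s t. rank_N (\<delta> - t) (\<delta> - s)) (\<lambda>s t. rank_image (0 - t) (0 - s))
    (b \<circ> reflect \<delta>) (c \<circ> reflect 0) (2 * \<delta>)"
proof
  show "is_barcode_of_rank (\<lambda>s t. rank_N (\<delta> - t) (\<delta> - s)) (b \<circ> reflect \<delta>)"
    "is_barcode_of_rank (\<lambda>s t. rank_image (0 - t) (0 - s)) (c \<circ> reflect 0)"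
    by (rule is_barcode_reflect[OF assms(1)], rule is_barcode_reflect[OF assms(2)])
  show "0 \<le> 2 * \<delta>" using \<delta> by simp
  have eq: "\<delta> - (t + 2 * \<delta>) = - t - \<delta>" "\<delta> - t = - t + \<delta>" for t
    by simp_all
  show "rank_image (0 - t) (0 - s) \<le> rank_N (\<delta> - t) (\<delta> - s)" if "s \<le> t" for s t
    unfolding eq(2)[of t] eq(2)[of s] diff_0 by (rule right_image_le) (use that in simp)
  show "rank_N (\<delta> - (t + 2 * \<delta>)) (\<delta> - s) \<le> rank_image (0 - t) (0 - s)" if "s \<le> t" for s t
    unfolding eq(1) eq(2)[of s] diff_0 by (rule right_image_le') (use that in simp)
  show "rank_image (0 - t) (0 - s) + rank_N (\<delta> - t) (\<delta> - s')
      \<le> rank_N (\<delta> - t) (\<delta> - s) + rank_image (0 - t) (0 - s')" if "s' \<le> s" "s \<le> t" for s' s t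
    unfolding eq(2)[of t] eq(2)[of s] eq(2)[of s'] diff_0
    by (rule right_image_diff) (use that in simp_all)
  show "rank_N (\<delta> - (t + 2 * \<delta>)) (\<delta> - s) + rank_image (0 - t) (0 - s')
      \<le> rank_image (0 - t) (0 - s) + rank_N (\<delta> - (t + 2 * \<delta>)) (\<delta> - s')"
    if "s' \<le> s" "s \<le> t" for s' s t
    unfolding eq(1) eq(2)[of s] eq(2)[of s'] diff_0
    by (rule right_image_diff') (use that in simp_all)
qed

theorem algebraic_stability:
  "bottleneck_dist (barcode sM M \<phi>) (barcode sN N \<psi>) \<le> ereal \<delta>"
proof -
  note bM = is_barcode_of_rank_barcode[OF rank_function_rank_inv[OF VM M pfdM]]
  note bN = is_barcode_of_rank_barcode[OF rank_function_rank_inv[OF VN N pfdN]]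
  note bQ = rank_function.is_barcode_bars[OF rank_function_image]
  show ?thesis
    by (rule bottleneck_le[OF bM bN bQ \<delta> left_domination_image[OF bM bQ] right_domination_image[OF bN bQ]])
qed

end

section \<open>Restriction to a line\<close>

lemma line_pt_mono:
  assumes "\<And>i. 0 < m i" "s \<le> t"
  shows "line_pt m b s \<le> line_pt m b t"
  unfolding line_pt_def le_fun_def using assms by (simp add: mult_right_mono less_imp_le)

lemma shift_line_pt_le:
  fixes m :: "'n::finite \<Rightarrow> real"
  assumes "0 < Min (range m)" "0 \<le> e"
  shows "shift (line_pt m b s) e \<le> line_pt m b (s + e / Min (range m))"
  unfolding le_fun_def
proof
  fix i
  have "Min (range m) \<le> m i" by simp
  then have "e / Min (range m) * Min (range m) \<le> e / Min (range m) * m i"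
    using divide_nonneg_pos[OF assms(2,1)] by (rule mult_left_mono)
  then show "shift (line_pt m b s) e i \<le> line_pt m b (s + e / Min (range m)) i"
    using assms(1) unfolding shift_def line_pt_def by (simp add: distrib_right)
qed

lemma shift_mono: "u \<le> v \<Longrightarrow> shift u e \<le> shift v e"
  unfolding shift_def le_fun_def by simp

lemma shift_shift: "shift (shift u e) e = shift u (2 * e)"
  unfolding shift_def by (simp add: fun_eq_iff)

lemma shift_ge: "0 \<le> e \<Longrightarrow> u \<le> shift u e"
  unfolding shift_def le_fun_def by simp

lemma pers_space_restrict_line:
  fixes P :: "('n \<Rightarrow> real) \<Rightarrow> 'v::ab_group_add set"
  assumes P: "pers_space s P \<phi>" and m: "\<And>i. 0 < m i"
  shows "pers_space s (restrict_line_sp P m b) (restrict_line_map \<phi> m b)"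
proof -
  have le: "line_pt m b t \<le> line_pt m b u" if "t \<le> u" for t u
    using line_pt_mono[OF m that] .
  show ?thesis
    unfolding pers_space_def restrict_line_sp_def restrict_line_map_def
  proof (intro conjI allI impI ballI)
    fix t u v :: real and x :: 'v
    have P1: "\<forall>u. module.subspace s (P u)"
      using P unfolding pers_space_def by (elim conjE)
    have P3: "\<forall>u. \<forall>x\<in>P u. \<phi> u u x = x"
      using P unfolding pers_space_def by (elim conjE)
    show "module.subspace s (P (line_pt m b t))" by (rule P1[rule_format])
    show "\<phi> (line_pt m b t) (line_pt m b t) x = x" if "x \<in> P (line_pt m b t)"
      by (rule P3[rule_format, OF that])
    assume tu: "t \<le> u"
    show "lin_on s s (P (line_pt m b t)) (\<phi> (line_pt m b t) (line_pt m b u))"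
      "\<phi> (line_pt m b t) (line_pt m b u) ` P (line_pt m b t) \<subseteq> P (line_pt m b u)"
      by (rule pers_lin[OF P le[OF tu]])+
    assume uv: "u \<le> v" and x: "x \<in> P (line_pt m b t)"
    show "\<phi> (line_pt m b u) (line_pt m b v) (\<phi> (line_pt m b t) (line_pt m b u) x)
        = \<phi> (line_pt m b t) (line_pt m b v) x"
      by (rule pers_comp[OF P, OF le[OF tu] le[OF uv] x])
  qed
qed

lemma pfd_restrict_line: "pfd s P \<Longrightarrow> pfd s (restrict_line_sp P m b)"
  unfolding pfd_def restrict_line_sp_def by blast


text \<open>The shifted point at which \<alpha> takes its value need not lie on the line; a
  transition map carries the value on to the line point with parameter \<open>s + d\<close>.\<close>

definition line_morphism :: "(('n \<Rightarrow> real) \<Rightarrow> ('n \<Rightarrow> real) \<Rightarrow> 'w \<Rightarrow> 'w) \<Rightarrow> ('n \<Rightarrow> real) \<Rightarrow> ('n \<Rightarrow> real)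
    \<Rightarrow> real \<Rightarrow> real \<Rightarrow> (('n \<Rightarrow> real) \<Rightarrow> 'v \<Rightarrow> 'w) \<Rightarrow> real \<Rightarrow> 'v \<Rightarrow> 'w" where
  "line_morphism \<psi> m b e d \<alpha> s x =
     \<psi> (shift (line_pt m b s) e) (line_pt m b (s + d)) (\<alpha> (line_pt m b s) x)"

locale shifted_line =
  fixes m b :: "'n \<Rightarrow> real" and e d :: real
  assumes mono: "\<And>s t. s \<le> t \<Longrightarrow> line_pt m b s \<le> line_pt m b t"
    and shift_le: "\<And>s. shift (line_pt m b s) e \<le> line_pt m b (s + d)"
    and d: "0 \<le> d" and e: "0 \<le> e"
begin

context
  fixes s1 :: "'f::field \<Rightarrow> 'v::ab_group_add \<Rightarrow> 'v" and s2 :: "'f \<Rightarrow> 'w::ab_group_add \<Rightarrow> 'w"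
    and M :: "('n \<Rightarrow> real) \<Rightarrow> 'v set" and \<phi> and N :: "('n \<Rightarrow> real) \<Rightarrow> 'w set" and \<psi> \<alpha>
  assumes \<alpha>: "shifted_morphism s1 M \<phi> s2 N \<psi> e \<alpha>" and N: "pers_space s2 N \<psi>"
begin

lemma \<alpha>_lin: "lin_on s1 s2 (M u) (\<alpha> u)" "\<alpha> u ` M u \<subseteq> N (shift u e)"
proof -
  have "\<forall>u. lin_on s1 s2 (M u) (\<alpha> u) \<and> \<alpha> u ` M u \<subseteq> N (shift u e)"
    using \<alpha> unfolding shifted_morphism_def by (elim conjE)
  from this[rule_format, of u]
  show "lin_on s1 s2 (M u) (\<alpha> u)" "\<alpha> u ` M u \<subseteq> N (shift u e)" by simp_all
qed

lemma \<alpha>_mem: "x \<in> M u \<Longrightarrow> \<alpha> u x \<in> N (shift u e)"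
  by (rule subsetD[OF \<alpha>_lin(2) imageI])

lemma \<alpha>_nat:
  assumes "u \<le> v" "x \<in> M u"
  shows "\<alpha> v (\<phi> u v x) = \<psi> (shift u e) (shift v e) (\<alpha> u x)"
proof -
  have "\<forall>u v. u \<le> v \<longrightarrow> (\<forall>x\<in>M u. \<alpha> v (\<phi> u v x) = \<psi> (shift u e) (shift v e) (\<alpha> u x))"
    using \<alpha> unfolding shifted_morphism_def by (elim conjE)
  from this[rule_format, OF assms] show ?thesis .
qed

lemma line_morphism_lin:
  "lin_on s1 s2 (restrict_line_sp M m b t) (line_morphism \<psi> m b e d \<alpha> t)"
  unfolding line_morphism_def restrict_line_sp_def
  by (rule lin_on_compose[OF \<alpha>_lin pers_lin(1)[OF N shift_le]])

lemma line_morphism_image: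
  "line_morphism \<psi> m b e d \<alpha> t ` restrict_line_sp M m b t \<subseteq> restrict_line_sp N m b (t + d)"
proof (rule image_subsetI)
  fix x assume "x \<in> restrict_line_sp M m b t"
  then have "\<alpha> (line_pt m b t) x \<in> N (shift (line_pt m b t) e)"
    unfolding restrict_line_sp_def by (rule \<alpha>_mem)
  then show "line_morphism \<psi> m b e d \<alpha> t x \<in> restrict_line_sp N m b (t + d)"
    unfolding line_morphism_def restrict_line_sp_def
    by (rule subsetD[OF pers_lin(2)[OF N shift_le] imageI])
qed

text \<open>Both sides equal the transition map from \<open>shift (line_pt m b s) e\<close> to the
  line point at \<open>t + d\<close>, applied to the value of \<alpha>.\<close>

lemma line_morphism_natural:
  assumes st: "s \<le> t" and x: "x \<in> restrict_line_sp M m b s"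
  shows "line_morphism \<psi> m b e d \<alpha> t (restrict_line_map \<phi> m b s t x)
    = restrict_line_map \<psi> m b (s + d) (t + d) (line_morphism \<psi> m b e d \<alpha> s x)"
proof -
  define L where "L = line_pt m b"
  have x: "x \<in> M (L s)" using x unfolding restrict_line_sp_def L_def .
  have le: "L s \<le> L t" "L (s + d) \<le> L (t + d)" "shift (L s) e \<le> L (s + d)" "shift (L t) e \<le> L (t + d)"
    using mono st shift_le unfolding L_def by simp_all
  note \<alpha>x = \<alpha>_mem[OF x]
  have "\<psi> (shift (L t) e) (L (t + d)) (\<alpha> (L t) (\<phi> (L s) (L t) x))
      = \<psi> (shift (L s) e) (L (t + d)) (\<alpha> (L s) x)"
    unfolding \<alpha>_nat[OF le(1) x] by (rule pers_comp[OF N, OF shift_mono[OF le(1)] le(4) \<alpha>x])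
  also have "\<dots> = \<psi> (L (s + d)) (L (t + d)) (\<psi> (shift (L s) e) (L (s + d)) (\<alpha> (L s) x))"
    by (rule pers_comp[OF N, OF le(3,2) \<alpha>x, symmetric])
  finally show ?thesis unfolding line_morphism_def restrict_line_map_def L_def .
qed

end

text \<open>Naturality of \<beta> moves it past the transition map that follows \<alpha>. Then
  \<beta> meets \<alpha> directly, \<open>comp\<close> turns the two into a transition map by
  \<open>2 * e\<close>, and all remaining transition maps compose.\<close>

lemma line_morphism_comp:
  assumes \<alpha>: "shifted_morphism s1 M \<phi> s2 N \<psi> e \<alpha>" and \<beta>: "shifted_morphism s2 N \<psi> s1 M \<phi> e \<beta>"
    and M: "pers_space s1 M \<phi>" and N: "pers_space s2 N \<psi>"
    and comp: "\<forall>u. \<forall>x\<in>M u. \<beta> (shift u e) (\<alpha> u x) = \<phi> u (shift u (2 * e)) x"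
    and x: "x \<in> restrict_line_sp M m b t"
  shows "line_morphism \<phi> m b e d \<beta> (t + d) (line_morphism \<psi> m b e d \<alpha> t x)
    = restrict_line_map \<phi> m b t (t + 2 * d) x"
proof -
  define L where "L = line_pt m b"
  have x: "x \<in> M (L t)" using x unfolding restrict_line_sp_def L_def .
  have le: "shift (L t) e \<le> L (t + d)" "shift (L (t + d)) e \<le> L (t + d + d)"
    unfolding L_def by (rule shift_le)+
  have le2: "L t \<le> shift (L t) (2 * e)" using e by (intro shift_ge) simp
  have le3: "shift (L t) (2 * e) \<le> shift (L (t + d)) e"
    using shift_mono[OF le(1), of e] unfolding shift_shift .
  have le4: "shift (L t) (2 * e) \<le> L (t + d + d)" using le3 le(2) by (rule order_trans)
  have \<phi>x: "\<phi> (L t) (shift (L t) (2 * e)) x \<in> M (shift (L t) (2 * e))"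
    by (rule subsetD[OF pers_lin(2)[OF M le2] imageI[OF x]])
  have "\<beta> (L (t + d)) (\<psi> (shift (L t) e) (L (t + d)) (\<alpha> (L t) x))
      = \<phi> (shift (L t) (2 * e)) (shift (L (t + d)) e) (\<phi> (L t) (shift (L t) (2 * e)) x)"
    unfolding \<alpha>_nat[OF \<beta> M, OF le(1) \<alpha>_mem[OF \<alpha> N, OF x]] shift_shift comp[rule_format, OF x] by (rule refl)
  then have "\<phi> (shift (L (t + d)) e) (L (t + d + d))
      (\<beta> (L (t + d)) (\<psi> (shift (L t) e) (L (t + d)) (\<alpha> (L t) x)))
      = \<phi> (shift (L t) (2 * e)) (L (t + d + d)) (\<phi> (L t) (shift (L t) (2 * e)) x)"
    using pers_comp[OF M, OF le3 le(2) \<phi>x] by simp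
  also have "\<dots> = \<phi> (L t) (L (t + d + d)) x"
    by (rule pers_comp[OF M, OF le2 le4 x])
  also have "t + d + d = t + 2 * d" by simp
  finally show ?thesis
    unfolding line_morphism_def restrict_line_map_def L_def by (simp add: add.assoc)
qed

end

lemma bottleneck_dist_line_le:
  fixes m b :: "'n::finite \<Rightarrow> real"
  assumes VM: "vector_space sM" and VN: "vector_space sN"
    and M: "pers_space sM M phiM" and N: "pers_space sN N phiN"
    and pfdM: "pfd sM M" and pfdN: "pfd sN N"
    and il: "interleaved sM M phiM sN N phiN e" and e: "0 \<le> e"
    and pos: "0 < Min (range m)"
  shows "bottleneck_dist (barcode sM (restrict_line_sp M m b) (restrict_line_map phiM m b))
      (barcode sN (restrict_line_sp N m b) (restrict_line_map phiN m b)) \<le> ereal (e / Min (range m))"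
proof -
  define d where "d = e / Min (range m)"
  have m: "0 < m i" for i
    using pos Min_le[of "range m" "m i"] by simp
  have d: "0 \<le> d" unfolding d_def using e pos by (rule divide_nonneg_pos)
  interpret shifted_line m b e d
  proof
    show "shift (line_pt m b s) e \<le> line_pt m b (s + d)" for s
      unfolding d_def by (rule shift_line_pt_le[OF pos e])
    show "line_pt m b s \<le> line_pt m b t" if "s \<le> t" for s t
      by (rule line_pt_mono[OF m that])
  qed (rule d e)+
  obtain \<alpha> \<beta> where \<alpha>: "shifted_morphism sM M phiM sN N phiN e \<alpha>"
    and \<beta>: "shifted_morphism sN N phiN sM M phiM e \<beta>"
    and \<beta>\<alpha>: "\<forall>u. \<forall>x\<in>M u. \<beta> (shift u e) (\<alpha> u x) = phiM u (shift u (2 * e)) x"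
    and \<alpha>\<beta>: "\<forall>u. \<forall>y\<in>N u. \<alpha> (shift u e) (\<beta> u y) = phiN u (shift u (2 * e)) y"
    using il unfolding interleaved_def by (elim exE conjE)
  interpret L: interleaving_1d sM sN "restrict_line_sp M m b" "restrict_line_map phiM m b"
    "restrict_line_sp N m b" "restrict_line_map phiN m b" d
    "line_morphism phiN m b e d \<alpha>" "line_morphism phiM m b e d \<beta>"
    by (rule interleaving_1d.intro; (rule VM VN pfd_restrict_line[OF pfdM] pfd_restrict_line[OF pfdN]
      pers_space_restrict_line[OF M m] pers_space_restrict_line[OF N m] d
      line_morphism_lin[OF \<alpha> N] line_morphism_lin[OF \<beta> M]
      line_morphism_image[OF \<alpha> N] line_morphism_image[OF \<beta> M]
      line_morphism_natural[OF \<alpha> N] line_morphism_comp[OF \<alpha> \<beta> M N \<beta>\<alpha>]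
      line_morphism_comp[OF \<beta> \<alpha> N M \<alpha>\<beta>])?; assumption?)
  show ?thesis using L.algebraic_stability unfolding d_def .
qed

theorem theorem1:
  fixes sM :: "'f::field \<Rightarrow> 'v::ab_group_add \<Rightarrow> 'v"
    and sN :: "'f \<Rightarrow> 'w::ab_group_add \<Rightarrow> 'w"
    and M :: "('n::finite \<Rightarrow> real) \<Rightarrow> 'v set"
    and phiM :: "('n \<Rightarrow> real) \<Rightarrow> ('n \<Rightarrow> real) \<Rightarrow> 'v \<Rightarrow> 'v"
    and N :: "('n \<Rightarrow> real) \<Rightarrow> 'w set"
    and phiN :: "('n \<Rightarrow> real) \<Rightarrow> ('n \<Rightarrow> real) \<Rightarrow> 'w \<Rightarrow> 'w"
  assumes "vector_space sM" and "vector_space sN"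
    and "pers_space sM M phiM" and "pers_space sN N phiN"
    and "pfd sM M" and "pfd sN N"
  shows "matching_dist sM M phiM sN N phiN \<le> interleaving_dist sM M phiM sN N phiN"
  unfolding matching_dist_def interleaving_dist_def
proof (rule SUP_least, rule INF_greatest)
  fix mb :: "('n \<Rightarrow> real) \<times> ('n \<Rightarrow> real)" and e
  assume mb: "mb \<in> {(m, b). admissible_line m b}"
    and "e \<in> {e. 0 \<le> e \<and> interleaved sM M phiM sN N phiN e}"
  then have e: "0 \<le> e" "interleaved sM M phiM sN N phiN e" by simp_all
  obtain m b where mb_eq: "mb = (m, b)" by (cases mb)
  then have pos: "0 < Min (range m)" using mb unfolding admissible_line_def by simp
  let ?d = "bottleneck_dist (barcode sM (restrict_line_sp M m b) (restrict_line_map phiM m b))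
      (barcode sN (restrict_line_sp N m b) (restrict_line_map phiN m b))"
  \<comment> \<open>The weight of the line cancels the denominator of the interleaving parameter
    \<open>e / Min (range m)\<close>.\<close>
  have "ereal (Min (range m)) * ?d \<le> ereal (Min (range m)) * ereal (e / Min (range m))"
    by (rule ereal_mult_left_mono[OF bottleneck_dist_line_le[OF assms e(2,1) pos]])
      (simp only: zero_ereal_def ereal_less_eq less_imp_le[OF pos])
  also have "\<dots> = ereal e" using less_imp_neq[OF pos, symmetric] by simp
  finally show "ereal (Min (range (fst mb))) *
      bottleneck_dist
        (barcode sM (restrict_line_sp M (fst mb) (snd mb)) (restrict_line_map phiM (fst mb) (snd mb)))
        (barcode sN (restrict_line_sp N (fst mb) (snd mb)) (restrict_line_map phiN (fst mb) (snd mb)))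
      \<le> ereal e"
    unfolding mb_eq fst_conv snd_conv .
qed

end
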